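(* Let $W=(W(t))_{t\ge 0}$ be a standard Brownian motion in $\mathbb{R}^2$ started at the origin, and let $W[0,\infty)=\{W(t):t\ge 0\}\subset\mathbb{R}^2$ be its trace. Fix any $r>0$. Then almost surely, for every integer $n\ge 1$ there exists a vector $x\in\mathbb{R}^2$ with $|x|=r$ such that all of the points $0,x,2x,\dotsc,nx$ belong to $W[0,\infty)$. That is, almost surely the trace contains arbitrarily long arithmetic progressions starting at the origin and having the fixed difference $r$.
   Context: The difference of an arithmetic progression $a,a+x,a+2x,\dotsc$ in the plane is measured here by the Euclidean length $|x|$ of its step vector. "Fixed difference" means that this length is a prescribed number not depending on the length of the progression; the direction of $x$ may depend on the Brownian path and on $n$. *)

theory Defs
  imports "HOL-Probability.Probability"
begin

text \<open>
  Standard Brownian motion on a Euclidean space, started at the origin. The process is indexed by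
  all of \<^typ>\<open>real\<close>, but only the values at times \<open>t \<ge> 0\<close> are constrained. For \<open>s < t\<close> the density
  of the increment says that it is centred Gaussian with covariance \<open>(t - s) I\<close>; the second
  argument of \<^const>\<open>normal_density\<close> is the standard deviation. Start at the origin and path
  continuity are required almost surely only.
\<close>

locale standard_brownian_motion = prob_space M
  for M :: "'a measure" +
  fixes W :: "real \<Rightarrow> 'a \<Rightarrow> 'b::euclidean_space"
  assumes random_variable_W: "\<And>t. 0 \<le> t \<Longrightarrow> random_variable borel (W t)"
    and start_at_origin: "AE \<omega> in M. W 0 \<omega> = 0"
    and gaussian_increments: "\<And>s t. 0 \<le> s \<Longrightarrow> s < t \<Longrightarrow>
      distributed M lborel (\<lambda>\<omega>. W t \<omega> - W s \<omega>)
        (\<lambda>x. ennreal (\<Prod>b\<in>Basis. normal_density 0 (sqrt (t - s)) (x \<bullet> b)))"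
    and independent_increments: "\<And>(t :: nat \<Rightarrow> real) n. 0 \<le> t 0 \<Longrightarrow>
      (\<And>i. i < n \<Longrightarrow> t i \<le> t (Suc i)) \<Longrightarrow>
      indep_vars (\<lambda>_. borel) (\<lambda>i \<omega>. W (t (Suc i)) \<omega> - W (t i) \<omega>) {..<n}"
    and continuous_paths: "AE \<omega> in M. continuous_on {0..} (\<lambda>t. W t \<omega>)"

definition process_trace :: "(real \<Rightarrow> 'a \<Rightarrow> 'b) \<Rightarrow> 'a \<Rightarrow> 'b set" where
  "process_trace W \<omega> = (\<lambda>t. W t \<omega>) ` {0..}"

end

theory Submission
  imports Defs
begin

text \<open>
  The proof is a discretised second-moment argument. Fix \<open>n\<close>, mark \<open>m\<close> directions \<open>u\<^sub>i\<close> on an arc, and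
  ask for the path to enter the discs of radius \<open>e = r / (4 m)\<close> around \<open>k r u\<^sub>i\<close> for \<open>k = 1, \<dots>, n\<close>, the
  \<open>k\<close>-th one during a prescribed time window \<open>[a, a\<^sup>2]\<close>. The heat kernel \<open>1 / (2 \<pi> u)\<close> makes the mean
  occupation of a disc during such a window proportional to \<open>ln a\<close>, and the correlation of two
  directions at distance \<open>d\<close> exceeds the product of the means only by a factor \<open>O(1 + ln (1 / d))\<close>.
  All powers of this logarithm are integrable on the arc, so each block of \<open>n\<close> windows succeeds for
  some direction with probability bounded below, uniformly in \<open>m\<close> and \<open>a\<close>. Blocks whose windows are separated
  by gaps of ratio \<open>B\<close> decorrelate as \<open>B \<longrightarrow> \<infinity>\<close>; by Cauchy-Schwarz, among \<open>B\<close> such blocks one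
  succeeds with probability tending to \<open>1\<close>, still uniformly in \<open>m\<close>. The time horizon does not
  depend on \<open>m\<close>, so compactness of the path up to it turns approximate progressions into an exact one
  as \<open>m \<longrightarrow> \<infinity>\<close>.
\<close>

section \<open>Brownian motion on a time grid\<close>

definition heat :: "real \<Rightarrow> real ^ 2 \<Rightarrow> real" where
  "heat u y = exp (- (norm y)\<^sup>2 / (2 * u)) / (2 * pi * u)"

text \<open>The transition kernel of planar Brownian motion: the chance of being in \<open>Q\<close>
  a time \<open>u\<close> after standing at \<open>z\<close>. Values in \<open>ennreal\<close> make
  every integral below exist.\<close>

definition heat_hit :: "real \<Rightarrow> real ^ 2 \<Rightarrow> (real ^ 2) set \<Rightarrow> ennreal" where
  "heat_hit u z Q = (\<integral>\<^sup>+y. ennreal (heat u y) * indicator Q (z + y) \<partial>lborel)"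

lemma prod_normal_density_eq_heat:
  assumes "u > 0"
  shows "(\<Prod>b\<in>Basis. normal_density 0 (sqrt u) (y \<bullet> b)) = heat u y"
proof -
  have "(\<Prod>b\<in>Basis. normal_density 0 (sqrt u) (y \<bullet> b))
      = (\<Prod>b\<in>(Basis :: (real ^ 2) set). (1 / sqrt (2 * pi * u)) * exp (- (y \<bullet> b)\<^sup>2 / (2 * u)))"
    using assms by (simp add: normal_density_def)
  also have "\<dots> = (1 / sqrt (2 * pi * u)) ^ 2 * exp (\<Sum>b\<in>Basis. - (y \<bullet> b)\<^sup>2 / (2 * u))"
    by (subst prod.distrib) (simp add: exp_sum)
  also have "(\<Sum>b\<in>Basis. - (y \<bullet> b)\<^sup>2 / (2 * u)) = - (norm y)\<^sup>2 / (2 * u)"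
    unfolding norm_eq_sqrt_inner
    by (subst euclidean_inner) (simp add: sum_negf sum_divide_distrib power2_eq_square sum_nonneg)
  finally show ?thesis
    using assms by (simp add: heat_def power_divide)
qed

lemma borel_measurable_heat [measurable]: "heat u \<in> borel_measurable borel"
  unfolding heat_def[abs_def] by measurable

lemma borel_measurable_heat_hit [measurable]:
  assumes [measurable]: "Q \<in> sets borel"
  shows "(\<lambda>z. heat_hit u z Q) \<in> borel_measurable borel"
  unfolding heat_hit_def
  by (rule lborel.borel_measurable_nn_integral) (simp add: case_prod_unfold, measurable)

text \<open>The process \<open>S\<close> is a Brownian motion sampled at the multiples of \<open>h\<close>, and \<open>F\<close> its history.\<close>

locale planar_gaussian_walk = prob_space M
  for M :: "'a measure" +
  fixes F :: "nat \<Rightarrow> 'a measure" and S :: "nat \<Rightarrow> 'a \<Rightarrow> real ^ 2" and h :: real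
  assumes subalgebra_F: "\<And>p. subalgebra M (F p)"
    and F_mono: "\<And>p q. p \<le> q \<Longrightarrow> subalgebra (F q) (F p)"
    and S_adapted: "\<And>p. S p \<in> borel_measurable (F p)"
    and S_0: "\<And>\<omega>. S 0 \<omega> = 0"
    and h_pos: "h > 0"
    and gaussian_step: "\<And>p q H Q. p < q \<Longrightarrow> H \<in> borel_measurable (F p) \<Longrightarrow> Q \<in> sets borel \<Longrightarrow>
      (\<integral>\<^sup>+\<omega>. H \<omega> * indicator Q (S q \<omega>) \<partial>M)
        = (\<integral>\<^sup>+\<omega>. H \<omega> * heat_hit (real (q - p) * h) (S p \<omega>) Q \<partial>M)"

text \<open>The joint law agrees with the product of the marginal laws on rectangles, hence
  everywhere, and Tonelli applies. Independence is assumed in terms of events so that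
  \<open>X\<close> can be the identity map into a history while \<open>Y\<close> is a
  vector.\<close>

lemma (in prob_space) nn_integral_indep_pair:
  assumes X [measurable]: "X \<in> measurable M S" and Y [measurable]: "Y \<in> measurable M T"
    and indep: "\<And>A B. A \<in> sets S \<Longrightarrow> B \<in> sets T \<Longrightarrow>
      prob ((X -` A \<inter> space M) \<inter> (Y -` B \<inter> space M)) = prob (X -` A \<inter> space M) * prob (Y -` B \<inter> space M)"
    and f: "f \<in> borel_measurable (S \<Otimes>\<^sub>M T)"
  shows "(\<integral>\<^sup>+\<omega>. f (X \<omega>, Y \<omega>) \<partial>M) = (\<integral>\<^sup>+x. \<integral>\<^sup>+y. f (x, y) \<partial>distr M T Y \<partial>distr M S X)"
proof -
  interpret S: prob_space "distr M S X"
    by (rule prob_space_distr) fact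
  interpret T: prob_space "distr M T Y"
    by (rule prob_space_distr) fact
  have eq: "distr M S X \<Otimes>\<^sub>M distr M T Y = distr M (S \<Otimes>\<^sub>M T) (\<lambda>x. (X x, Y x))"
  proof (rule pair_measure_eqI)
    fix A B assume "A \<in> sets (distr M S X)" "B \<in> sets (distr M T Y)"
    then have AB [measurable]: "A \<in> sets S" "B \<in> sets T"
      by auto
    have "(\<lambda>x. (X x, Y x)) -` (A \<times> B) \<inter> space M = (X -` A \<inter> space M) \<inter> (Y -` B \<inter> space M)"
      by auto
    then show "emeasure (distr M S X) A * emeasure (distr M T Y) B
        = emeasure (distr M (S \<Otimes>\<^sub>M T) (\<lambda>x. (X x, Y x))) (A \<times> B)"
      using indep[OF AB] by (simp add: emeasure_distr emeasure_eq_measure ennreal_mult')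
  qed (auto intro: S.sigma_finite_measure_axioms T.sigma_finite_measure_axioms)
  have "(\<integral>\<^sup>+\<omega>. f (X \<omega>, Y \<omega>) \<partial>M) = (\<integral>\<^sup>+z. f z \<partial>distr M (S \<Otimes>\<^sub>M T) (\<lambda>x. (X x, Y x)))"
    using f by (subst nn_integral_distr) auto
  also have "\<dots> = (\<integral>\<^sup>+z. f z \<partial>(distr M S X \<Otimes>\<^sub>M distr M T Y))"
    by (simp add: eq)
  also have "\<dots> = (\<integral>\<^sup>+x. \<integral>\<^sup>+y. f (x, y) \<partial>distr M T Y \<partial>distr M S X)"
    by (rule T.nn_integral_fst[symmetric])
       (use f in \<open>simp add: measurable_cong_sets[OF sets_pair_measure_cong[OF sets_distr sets_distr] refl]\<close>)
  finally show ?thesis .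
qed

text \<open>The history is generated by the tuple of the first \<open>p\<close> increments.
  Recentring by \<open>W 0\<close> is harmless, since \<open>W 0\<close> vanishes almost surely, and
  makes the walk start at \<open>0\<close> for every outcome, as \<open>S_0\<close> demands.\<close>

lemma standard_brownian_motion_imp_walk:
  fixes W :: "real \<Rightarrow> 'a \<Rightarrow> real ^ 2" and h :: real
  assumes "standard_brownian_motion M W" and h: "h > 0"
  shows "\<exists>F. planar_gaussian_walk M F (\<lambda>p \<omega>. W (real p * h) \<omega> - W 0 \<omega>) h"
proof -
  interpret standard_brownian_motion M W by fact
  define S where "S = (\<lambda>p \<omega>. W (real p * h) \<omega> - W 0 \<omega>)"
  define D where "D = (\<lambda>l \<omega>. W (real (Suc l) * h) \<omega> - W (real l * h) \<omega>)"
  define past where "past = (\<lambda>p \<omega>. restrict (\<lambda>l. D l \<omega>) {..<p})"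
  define P where "P = (\<lambda>p. PiM {..<p::nat} (\<lambda>_. borel :: (real ^ 2) measure))"
  define F where "F = (\<lambda>p. vimage_algebra (space M) (past p) (P p))"
  have D [measurable]: "D l \<in> borel_measurable M" for l
    unfolding D_def using h by (intro borel_measurable_diff random_variable_W) auto
  have S_eq: "S p \<omega> = (\<Sum>l<p. D l \<omega>)" for p \<omega>
    unfolding S_def D_def using sum_lessThan_telescope[of "\<lambda>l. W (real l * h) \<omega>" p] by simp
  have past [measurable]: "past p \<in> measurable M (P p)" for p
    unfolding past_def P_def by (rule measurable_restrict) simp
  have past': "past p \<in> measurable (F p) (P p)" for p
    unfolding F_def by (rule measurable_vimage_algebra1) (auto simp: past_def P_def space_PiM)
  have space_F [simp]: "space (F p) = space M" for p
    by (simp add: F_def)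
  have sets_F: "sets (F p) = {past p -` A \<inter> space M | A. A \<in> sets (P p)}" for p
    unfolding F_def
    by (rule sets_vimage_algebra2) (auto simp: past_def P_def space_PiM)
  have sub_M: "subalgebra M (F p)" for p
    unfolding subalgebra_def using past[of p] by (auto simp: sets_F measurable_sets)
  have sub_mono: "subalgebra (F q) (F p)" if "p \<le> q" for p q
  proof -
    have "past p \<in> measurable (F q) (P p)"
    proof -
      have "(\<lambda>x. restrict x {..<p}) \<in> measurable (P q) (P p)"
        unfolding P_def using that by (intro measurable_restrict_subset) auto
      from measurable_comp[OF past' this] show ?thesis
        using that by (auto simp: past_def comp_def restrict_def fun_eq_iff cong: if_cong
          elim!: measurable_cong[THEN iffD1, rotated])
    qed
    then show ?thesis
      unfolding subalgebra_def by (auto simp: sets_F[of p] dest: measurable_sets)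
  qed
  have D_F: "D l \<in> borel_measurable (F p)" if "l < p" for l p
  proof -
    have "(\<lambda>x. x l) \<in> borel_measurable (P p)"
      unfolding P_def using that by (intro measurable_component_singleton) auto
    from measurable_comp[OF past' this] show ?thesis
      using that by (simp add: past_def comp_def)
  qed
  have S_F: "S p \<in> borel_measurable (F p)" for p
    unfolding S_eq[abs_def] by (rule borel_measurable_sum) (auto intro: D_F)
  have indep: "prob (((\<lambda>\<omega>. \<omega>) -` A \<inter> space M) \<inter> ((\<lambda>\<omega>. S q \<omega> - S p \<omega>) -` B \<inter> space M))
      = prob ((\<lambda>\<omega>. \<omega>) -` A \<inter> space M) * prob ((\<lambda>\<omega>. S q \<omega> - S p \<omega>) -` B \<inter> space M)"
    if "p < q" and A: "A \<in> sets (F p)" and B: "B \<in> sets borel" for p q A B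
  proof -
    have "indep_vars (\<lambda>_. borel) D {..<q}"
      unfolding D_def using h
      by (intro independent_increments[where t = "\<lambda>i. real i * h"]) (auto simp: mult_right_mono)
    \<comment> \<open>The increments before \<open>p\<close> and those from \<open>p\<close> to
      \<open>q\<close> are two disjoint groups of an independent family; \<open>S q - S p\<close>
      depends on the second group only.\<close>
    then have *: "indep_var (P p) (past p) (PiM {p..<q} (\<lambda>_. borel)) (\<lambda>\<omega>. restrict (\<lambda>l. D l \<omega>) {p..<q})"
      unfolding P_def past_def using that by (intro indep_var_restrict) auto
    obtain A' where A': "A' \<in> sets (P p)" "A = past p -` A' \<inter> space M"
      using A unfolding sets_F by blast
    define B' where "B' = (\<lambda>x. \<Sum>l\<in>{p..<q}. x l) -` B \<inter> space (PiM {p..<q} (\<lambda>_. borel :: (real ^ 2) measure))"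
    have B': "B' \<in> sets (PiM {p..<q} (\<lambda>_. borel))"
      unfolding B'_def by (rule measurable_sets[OF _ B]) measurable
    have diff: "(\<Sum>l = p..<q. D l \<omega>) = S q \<omega> - S p \<omega>" for \<omega>
      using that sum_diff_nat_ivl[of 0 p q "\<lambda>l. D l \<omega>"] by (simp add: S_eq lessThan_atLeast0)
    have e1: "(\<lambda>\<omega>. S q \<omega> - S p \<omega>) -` B \<inter> space M = (\<lambda>\<omega>. restrict (\<lambda>l. D l \<omega>) {p..<q}) -` B' \<inter> space M"
      unfolding B'_def by (auto simp: space_PiM diff)
    have e2: "((\<lambda>\<omega>. \<omega>) -` A \<inter> space M) = past p -` A' \<inter> space M"
      by (auto simp: A')
    have e3: "(\<lambda>\<omega>. (past p \<omega>, restrict (\<lambda>l. D l \<omega>) {p..<q})) -` (A' \<times> B') \<inter> space M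
        = (past p -` A' \<inter> space M) \<inter> ((\<lambda>\<omega>. restrict (\<lambda>l. D l \<omega>) {p..<q}) -` B' \<inter> space M)"
      by auto
    show ?thesis
      unfolding e1 e2 using indep_varD[OF * A'(1) B'] unfolding e3 .
  qed
  have S_M: "S p \<in> borel_measurable M" for p
    using measurable_from_subalg[OF sub_M S_F] .
  have step: "(\<integral>\<^sup>+\<omega>. H \<omega> * indicator Q (S q \<omega>) \<partial>M)
        = (\<integral>\<^sup>+\<omega>. H \<omega> * heat_hit (real (q - p) * h) (S p \<omega>) Q \<partial>M)"
    if "p < q" and H [measurable]: "H \<in> borel_measurable (F p)" and Q [measurable]: "Q \<in> sets borel" for p q H Q
  proof -
    have u: "real q * h - real p * h = real (q - p) * h" "real (q - p) * h > 0"
      using that h by (auto simp: of_nat_diff algebra_simps)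
    have "distributed M lborel (\<lambda>\<omega>. W (real q * h) \<omega> - W (real p * h) \<omega>)
        (\<lambda>x. ennreal (\<Prod>b\<in>Basis. normal_density 0 (sqrt (real q * h - real p * h)) (x \<bullet> b)))"
      using that h by (intro gaussian_increments) auto
    then have "distributed M lborel (\<lambda>\<omega>. S q \<omega> - S p \<omega>) (\<lambda>x. ennreal (heat (real (q - p) * h) x))"
      by (simp add: u prod_normal_density_eq_heat S_def)
    then have distr: "distr M borel (\<lambda>\<omega>. S q \<omega> - S p \<omega>) = density lborel (\<lambda>x. ennreal (heat (real (q - p) * h) x))"
      unfolding distributed_def using distr_cong[OF refl sets_lborel, of M "\<lambda>\<omega>. S q \<omega> - S p \<omega>" "\<lambda>\<omega>. S q \<omega> - S p \<omega>"]
      by simp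
    note S_F[measurable]
    have f: "(\<lambda>z. H (fst z) * indicator Q (S p (fst z) + snd z)) \<in> borel_measurable (F p \<Otimes>\<^sub>M borel)"
      by measurable
    \<comment> \<open>The outcome itself, seen in the history at \<open>p\<close>, is the past
      variable: Tonelli then freezes the history and integrates out the increment
      \<open>S q - S p\<close>.\<close>
    have id: "(\<lambda>\<omega>. \<omega>) \<in> measurable M (F p)"
      by (rule measurable_from_subalg[OF sub_M[of p]]) simp
    have "(\<integral>\<^sup>+\<omega>. H \<omega> * indicator Q (S q \<omega>) \<partial>M)
      = (\<integral>\<^sup>+x. \<integral>\<^sup>+y. H x * indicator Q (S p x + y) \<partial>density lborel (\<lambda>x. ennreal (heat (real (q - p) * h) x))
          \<partial>distr M (F p) (\<lambda>\<omega>. \<omega>))"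
      using nn_integral_indep_pair[OF id borel_measurable_diff[OF S_M S_M] indep[OF \<open>p < q\<close>] f]
      by (simp only: distr fst_conv snd_conv add_diff_eq add_diff_cancel_left')
    also have "\<dots> = (\<integral>\<^sup>+x. H x * heat_hit (real (q - p) * h) (S p x) Q \<partial>distr M (F p) (\<lambda>\<omega>. \<omega>))"
      unfolding heat_hit_def
      by (intro nn_integral_cong, subst nn_integral_density, measurable, subst nn_integral_cmult[symmetric], measurable)
         (simp add: mult_ac)
    also have "\<dots> = (\<integral>\<^sup>+x. H x * heat_hit (real (q - p) * h) (S p x) Q \<partial>M)"
      by (subst nn_integral_distr[OF id]) measurable
    finally show ?thesis .
  qed
  have "planar_gaussian_walk M F S h"
    by unfold_locales (rule sub_M sub_mono S_F h step | assumption | simp add: S_def)+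
  then show ?thesis
    unfolding S_def by blast
qed

section \<open>One-step and one-window estimates\<close>

lemma nn_integral_indicator_translate:
  fixes z :: "'b::euclidean_space"
  assumes [measurable]: "Q \<in> sets borel"
  shows "(\<integral>\<^sup>+y. indicator Q (z + y) \<partial>lborel) = emeasure lborel Q"
proof -
  have "emeasure lborel Q = (\<integral>\<^sup>+y. indicator Q y \<partial>distr lborel borel ((+) z))"
    by (simp add: lborel_distr_plus)
  also have "\<dots> = (\<integral>\<^sup>+y. indicator Q (z + y) \<partial>lborel)"
    by (subst nn_integral_distr) auto
  finally show ?thesis ..
qed

lemma heat_le: "u > 0 \<Longrightarrow> heat u y \<le> 1 / (2 * pi * u)"
  by (simp add: heat_def divide_right_mono)

text \<open>\<open>exp (- s) \<le> 1 / s\<close> with \<open>s = |y|^2 / (2 u)\<close> removes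
  \<open>u\<close> altogether: the bound is uniform in time, which is what short lags between
  separated discs require.\<close>

lemma heat_le_far:
  assumes "u > 0" "y \<noteq> 0"
  shows "heat u y \<le> 1 / (pi * (norm y)\<^sup>2)"
proof -
  define s where "s = (norm y)\<^sup>2 / (2 * u)"
  have s: "s > 0"
    using assms by (simp add: s_def)
  have "s \<le> exp s"
    using exp_ge_add_one_self[of s] by linarith
  then have "exp (- s) \<le> 1 / s"
    using s by (simp add: exp_minus field_simps)
  then have "exp (- s) / (2 * pi * u) \<le> (1 / s) / (2 * pi * u)"
    using assms by (intro divide_right_mono) auto
  also have "\<dots> = 1 / (pi * (norm y)\<^sup>2)"
    using assms by (simp add: s_def field_simps)
  finally show ?thesis
    by (simp add: heat_def s_def)
qed

lemma heat_ge:
  assumes "u > 0" "norm y \<le> 2 * R"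
  shows "heat u y \<ge> exp (- 2 * R\<^sup>2 / u) / (2 * pi * u)"
proof -
  have "(norm y)\<^sup>2 \<le> (2 * R)\<^sup>2"
    using assms by (intro power_mono) auto
  then show ?thesis
    using assms unfolding heat_def by (intro divide_right_mono) (auto simp: field_simps power2_eq_square)
qed

lemma heat_hit_le:
  assumes [measurable]: "Q \<in> sets borel" and "\<And>y. y \<in> Q \<Longrightarrow> heat u (y - z) \<le> c"
  shows "heat_hit u z Q \<le> ennreal c * emeasure lborel Q"
proof -
  have "heat_hit u z Q \<le> (\<integral>\<^sup>+y. ennreal c * indicator Q (z + y) \<partial>lborel)"
    unfolding heat_hit_def
    by (intro nn_integral_mono) (use assms(2)[of "z + _"] in \<open>auto simp: indicator_def intro!: ennreal_leI\<close>)
  then show ?thesis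
    by (simp add: nn_integral_cmult nn_integral_indicator_translate)
qed

lemma heat_hit_ge:
  assumes [measurable]: "Q \<in> sets borel" and "\<And>y. y \<in> Q \<Longrightarrow> c \<le> heat u (y - z)"
  shows "ennreal c * emeasure lborel Q \<le> heat_hit u z Q"
proof -
  have "(\<integral>\<^sup>+y. ennreal c * indicator Q (z + y) \<partial>lborel) \<le> heat_hit u z Q"
    unfolding heat_hit_def
    by (intro nn_integral_mono) (use assms(2)[of "z + _"] in \<open>auto simp: indicator_def intro!: ennreal_leI\<close>)
  then show ?thesis
    by (simp add: nn_integral_cmult nn_integral_indicator_translate)
qed

lemma emeasure_lborel_disc:
  assumes "e \<ge> 0"
  shows "emeasure lborel (ball (x :: real ^ 2) e) = ennreal (pi * e\<^sup>2)"
  using assms by (simp add: emeasure_ball unit_ball_vol_2)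

lemma ball_in_sets_borel [measurable]: "ball (x :: real ^ 2) e \<in> sets borel"
  by simp

context planar_gaussian_walk
begin

lemma S_measurable [measurable]: "S p \<in> borel_measurable M"
  using measurable_from_subalg[OF subalgebra_F S_adapted] .

lemma measurable_F_M: "f \<in> borel_measurable (F p) \<Longrightarrow> f \<in> borel_measurable M"
  using measurable_from_subalg[OF subalgebra_F] .

lemma measurable_F_mono: "f \<in> borel_measurable (F p) \<Longrightarrow> p \<le> q \<Longrightarrow> f \<in> borel_measurable (F q)"
  using measurable_from_subalg[OF F_mono] .

lemma S_measurable_F: "p \<le> q \<Longrightarrow> S p \<in> borel_measurable (F q)"
  using measurable_F_mono[OF S_adapted] .

text \<open>An arbitrary nonnegative weight \<open>H\<close> known at time \<open>p\<close> takes
  the place of conditioning on the past, so such bounds can be iterated by absorbing indicators into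
  the weight. \<open>Z\<close> confines the walk at time \<open>p\<close> where \<open>H\<close>
  does not vanish.\<close>

lemma step_le:
  assumes "p < q" and H: "H \<in> borel_measurable (F p)" and e: "e \<ge> 0" "c \<ge> 0"
    and supp: "\<And>\<omega>. H \<omega> \<noteq> 0 \<Longrightarrow> S p \<omega> \<in> Z"
    and c: "\<And>y z. y \<in> ball x e \<Longrightarrow> z \<in> Z \<Longrightarrow> heat (real (q - p) * h) (y - z) \<le> c"
  shows "(\<integral>\<^sup>+\<omega>. H \<omega> * indicator (ball x e) (S q \<omega>) \<partial>M) \<le> ennreal (c * (pi * e\<^sup>2)) * (\<integral>\<^sup>+\<omega>. H \<omega> \<partial>M)"
proof -
  have "(\<integral>\<^sup>+\<omega>. H \<omega> * indicator (ball x e) (S q \<omega>) \<partial>M)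
      = (\<integral>\<^sup>+\<omega>. H \<omega> * heat_hit (real (q - p) * h) (S p \<omega>) (ball x e) \<partial>M)"
    using assms by (intro gaussian_step) auto
  also have "\<dots> \<le> (\<integral>\<^sup>+\<omega>. ennreal (c * (pi * e\<^sup>2)) * H \<omega> \<partial>M)"
  proof (intro nn_integral_mono)
    fix \<omega>
    show "H \<omega> * heat_hit (real (q - p) * h) (S p \<omega>) (ball x e) \<le> ennreal (c * (pi * e\<^sup>2)) * H \<omega>"
    proof (cases "H \<omega> = 0")
      case False
      then have "heat_hit (real (q - p) * h) (S p \<omega>) (ball x e) \<le> ennreal c * emeasure lborel (ball x e)"
        using supp by (intro heat_hit_le c) auto
      then show ?thesis
        using e by (subst mult.commute) (auto simp: emeasure_lborel_disc ennreal_mult[symmetric] intro!: mult_right_mono)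
    qed simp
  qed
  also have "\<dots> = ennreal (c * (pi * e\<^sup>2)) * (\<integral>\<^sup>+\<omega>. H \<omega> \<partial>M)"
    using measurable_F_M[OF H] by (intro nn_integral_cmult)
  finally show ?thesis .
qed

lemma step_le_disc:
  assumes "p < q" "H \<in> borel_measurable (F p)" "e \<ge> 0"
  shows "(\<integral>\<^sup>+\<omega>. H \<omega> * indicator (ball x e) (S q \<omega>) \<partial>M)
    \<le> ennreal (e\<^sup>2 / (2 * (real (q - p) * h))) * (\<integral>\<^sup>+\<omega>. H \<omega> \<partial>M)"
  using step_le[where c = "1 / (2 * pi * (real (q - p) * h))" and Z = UNIV, OF assms(1-3)] h_pos assms(1)
  by (auto simp: heat_le)

lemma step_le_far:
  assumes "p < q" "H \<in> borel_measurable (F p)" "e \<ge> 0" "d > 0" and d: "dist x x' \<ge> d + 2 * e"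
    and supp: "\<And>\<omega>. H \<omega> \<noteq> 0 \<Longrightarrow> S p \<omega> \<in> ball x e"
  shows "(\<integral>\<^sup>+\<omega>. H \<omega> * indicator (ball x' e) (S q \<omega>) \<partial>M)
    \<le> ennreal (e\<^sup>2 / d\<^sup>2) * (\<integral>\<^sup>+\<omega>. H \<omega> \<partial>M)"
proof -
  have "heat (real (q - p) * h) (y - z) \<le> 1 / (pi * d\<^sup>2)" if "y \<in> ball x' e" "z \<in> ball x e" for y z
  proof -
    have "dist x x' \<le> dist x z + dist z y + dist y x'"
      using dist_triangle[of x x' z] dist_triangle[of z x' y] by linarith
    then have *: "d \<le> norm (y - z)"
      using d that by (auto simp: dist_norm norm_minus_commute)
    have "heat (real (q - p) * h) (y - z) \<le> 1 / (pi * (norm (y - z))\<^sup>2)"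
      using assms * h_pos by (intro heat_le_far) auto
    also have "\<dots> \<le> 1 / (pi * d\<^sup>2)"
      using assms * by (intro divide_left_mono mult_left_mono power_mono mult_pos_pos) auto
    finally show ?thesis .
  qed
  from step_le[where c = "1 / (pi * d\<^sup>2)" and Z = "ball x e", OF assms(1-3) _ supp this]
  show ?thesis
    by simp
qed

text \<open>Start and end lie within \<open>R\<close> of the origin, hence at distance at most
  \<open>2 * R\<close>. The exponential factor is the whole loss against \<open>step_le_disc\<close>
  and tends to \<open>1\<close> as the lag grows.\<close>

lemma step_ge_disc:
  assumes "p < q" and H: "H \<in> borel_measurable (F p)" and e: "e \<ge> 0"
    and supp: "\<And>\<omega>. H \<omega> \<noteq> 0 \<Longrightarrow> norm (S p \<omega>) \<le> R" and "ball x e \<subseteq> cball 0 R"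
  shows "ennreal (exp (- 2 * R\<^sup>2 / (real (q - p) * h)) * (e\<^sup>2 / (2 * (real (q - p) * h)))) * (\<integral>\<^sup>+\<omega>. H \<omega> \<partial>M)
    \<le> (\<integral>\<^sup>+\<omega>. H \<omega> * indicator (ball x e) (S q \<omega>) \<partial>M)"
proof -
  define u where "u = real (q - p) * h"
  have u: "u > 0"
    using assms h_pos by (simp add: u_def)
  define c where "c = exp (- 2 * R\<^sup>2 / u) / (2 * pi * u)"
  have c: "c \<ge> 0" "c * (pi * e\<^sup>2) = exp (- 2 * R\<^sup>2 / u) * (e\<^sup>2 / (2 * u))"
    using u by (auto simp: c_def)
  have "ennreal (c * (pi * e\<^sup>2)) * (\<integral>\<^sup>+\<omega>. H \<omega> \<partial>M) = (\<integral>\<^sup>+\<omega>. ennreal (c * (pi * e\<^sup>2)) * H \<omega> \<partial>M)"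
    using measurable_F_M[OF H] by (intro nn_integral_cmult[symmetric])
  also have "\<dots> \<le> (\<integral>\<^sup>+\<omega>. H \<omega> * heat_hit u (S p \<omega>) (ball x e) \<partial>M)"
  proof (intro nn_integral_mono)
    fix \<omega>
    show "ennreal (c * (pi * e\<^sup>2)) * H \<omega> \<le> H \<omega> * heat_hit u (S p \<omega>) (ball x e)"
    proof (cases "H \<omega> = 0")
      case False
      have "c \<le> heat u (y - S p \<omega>)" if "y \<in> ball x e" for y
        unfolding c_def
      proof (rule heat_ge[OF u])
        have "norm y \<le> R"
          using that assms(5) by auto
        then show "norm (y - S p \<omega>) \<le> 2 * R"
          using supp[OF False] norm_triangle_ineq4[of y "S p \<omega>"] by linarith
      qed
      then have "ennreal c * emeasure lborel (ball x e) \<le> heat_hit u (S p \<omega>) (ball x e)"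
        by (intro heat_hit_ge) auto
      then show ?thesis
        using e c by (subst mult.commute) (auto simp: emeasure_lborel_disc ennreal_mult[symmetric] intro!: mult_left_mono)
    qed simp
  qed
  also have "\<dots> = (\<integral>\<^sup>+\<omega>. H \<omega> * indicator (ball x e) (S q \<omega>) \<partial>M)"
    unfolding u_def using assms by (intro gaussian_step[symmetric]) auto
  finally show ?thesis
    unfolding c(2) u_def .
qed

section \<open>Occupation of discs during a set of grid times\<close>

definition hits :: "nat set \<Rightarrow> real ^ 2 \<Rightarrow> real \<Rightarrow> 'a \<Rightarrow> ennreal" where
  "hits I x e \<omega> = (\<Sum>p\<in>I. indicator (ball x e) (S p \<omega>))"

text \<open>The upper bound of \<open>step_le_disc\<close> for a walk observed from grid time
  \<open>0\<close>, summed over \<open>I\<close>. If all times in \<open>I\<close> are positive, it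
  bounds the mean of \<open>hits I x e\<close> for every centre \<open>x\<close>, and it is the
  scale by which hits will be normalised.\<close>

definition weight :: "nat set \<Rightarrow> real \<Rightarrow> real" where
  "weight I e = (\<Sum>p\<in>I. e\<^sup>2 / (2 * (real p * h)))"

lemma weight_nonneg: "weight I e \<ge> 0"
  unfolding weight_def using h_pos by (intro sum_nonneg) auto

lemma hits_measurable_F: "(\<And>p. p \<in> I \<Longrightarrow> p \<le> q) \<Longrightarrow> hits I x e \<in> borel_measurable (F q)"
  unfolding hits_def[abs_def]
  by (intro borel_measurable_sum measurable_compose[OF S_measurable_F] borel_measurable_indicator) auto

lemma hits_measurable [measurable]: "hits I x e \<in> borel_measurable M"
  unfolding hits_def[abs_def] by measurable

text \<open>Since \<open>p - p0\<close> is at least \<open>(1 - 1 / B) p\<close>, the bound from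
  \<open>p0\<close> exceeds the bound from time \<open>0\<close> by the factor
  \<open>B / (B - 1)\<close> at most: after a gap of ratio \<open>B\<close> the past is nearly
  forgotten.\<close>

lemma step_le_gap:
  assumes H: "H \<in> borel_measurable (F p0)" and e: "e \<ge> 0" and "B > 1" and p: "B * real p0 \<le> real p" "p > 0"
  shows "(\<integral>\<^sup>+\<omega>. H \<omega> * indicator (ball x e) (S p \<omega>) \<partial>M)
    \<le> ennreal (B / (B - 1) * (e\<^sup>2 / (2 * (real p * h)))) * (\<integral>\<^sup>+\<omega>. H \<omega> \<partial>M)"
proof -
  have p0: "p0 < p"
  proof (cases "p0 = 0")
    case False
    then have "real p0 < B * real p0"
      using \<open>B > 1\<close> by simp
    then show ?thesis
      using p(1) by linarith
  qed (use p in auto)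
  have "B * real (p - p0) \<ge> (B - 1) * real p"
    using p(1) p0 by (simp add: of_nat_diff algebra_simps)
  then have "1 / real (p - p0) \<le> B / ((B - 1) * real p)"
    using p0 \<open>B > 1\<close> by (simp add: field_simps)
  then have "1 / real (p - p0) * (e\<^sup>2 / (2 * h)) \<le> B / ((B - 1) * real p) * (e\<^sup>2 / (2 * h))"
    using h_pos by (intro mult_right_mono) auto
  then have *: "e\<^sup>2 / (2 * (real (p - p0) * h)) \<le> B / (B - 1) * (e\<^sup>2 / (2 * (real p * h)))"
    by (simp add: ac_simps)
  show ?thesis
    by (rule order_trans[OF step_le_disc[OF p0 H e]]) (intro mult_right_mono ennreal_leI *, simp)
qed

lemma window_le:
  assumes H: "H \<in> borel_measurable (F p0)" and e: "e \<ge> 0" and "B > 1"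
    and I: "\<And>p. p \<in> I \<Longrightarrow> B * real p0 \<le> real p \<and> p > 0"
  shows "(\<integral>\<^sup>+\<omega>. H \<omega> * hits I x e \<omega> \<partial>M) \<le> ennreal (B / (B - 1) * weight I e) * (\<integral>\<^sup>+\<omega>. H \<omega> \<partial>M)"
proof -
  note [measurable] = measurable_F_M[OF H]
  have "(\<integral>\<^sup>+\<omega>. H \<omega> * hits I x e \<omega> \<partial>M) = (\<Sum>p\<in>I. \<integral>\<^sup>+\<omega>. H \<omega> * indicator (ball x e) (S p \<omega>) \<partial>M)"
    unfolding hits_def sum_distrib_left by (intro nn_integral_sum) measurable
  also have "\<dots> \<le> (\<Sum>p\<in>I. ennreal (B / (B - 1) * (e\<^sup>2 / (2 * (real p * h)))) * (\<integral>\<^sup>+\<omega>. H \<omega> \<partial>M))"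
    using assms by (intro sum_mono step_le_gap) auto
  also have "\<dots> = ennreal (B / (B - 1) * weight I e) * (\<integral>\<^sup>+\<omega>. H \<omega> \<partial>M)"
    unfolding weight_def sum_distrib_right[symmetric] sum_distrib_left using h_pos \<open>B > 1\<close>
    by (subst sum_ennreal) auto
  finally show ?thesis .
qed

text \<open>The visit to the first disc at time \<open>p\<close> is absorbed into the weight;
  \<open>g\<close> then bounds each later visit by its lag, these bounds sum to at most
  \<open>G\<close>, and \<open>window_le\<close> handles the remaining sum over
  \<open>p\<close>.\<close>

lemma window_ordered_pair_le:
  assumes H: "H \<in> borel_measurable (F p0)" and e: "e \<ge> 0" and "B > 1"
    and I: "finite I" "\<And>p. p \<in> I \<Longrightarrow> B * real p0 \<le> real p \<and> p > 0"
    and g_nonneg: "\<And>u. g u \<ge> 0"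
    and g: "\<And>p q H. p \<in> I \<Longrightarrow> q \<in> I \<Longrightarrow> p \<le> q \<Longrightarrow> H \<in> borel_measurable (F p) \<Longrightarrow>
      (\<And>\<omega>. H \<omega> \<noteq> 0 \<Longrightarrow> S p \<omega> \<in> ball x e) \<Longrightarrow>
      (\<integral>\<^sup>+\<omega>. H \<omega> * indicator (ball y e) (S q \<omega>) \<partial>M) \<le> ennreal (g (q - p)) * (\<integral>\<^sup>+\<omega>. H \<omega> \<partial>M)"
    and G: "\<And>p. p \<in> I \<Longrightarrow> (\<Sum>q\<in>{q\<in>I. p \<le> q}. g (q - p)) \<le> G" "G \<ge> 0"
  shows "(\<integral>\<^sup>+\<omega>. H \<omega> * (\<Sum>p\<in>I. \<Sum>q\<in>{q\<in>I. p \<le> q}. indicator (ball x e) (S p \<omega>) * indicator (ball y e) (S q \<omega>)) \<partial>M)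
    \<le> ennreal (B / (B - 1) * weight I e * G) * (\<integral>\<^sup>+\<omega>. H \<omega> \<partial>M)"
proof -
  note [measurable] = measurable_F_M[OF H]
  define Hp where "Hp p \<omega> = H \<omega> * indicator (ball x e) (S p \<omega>)" for p \<omega>
  have p0: "p0 \<le> p" if "p \<in> I" for p
  proof -
    have "1 * real p0 \<le> B * real p0"
      using \<open>B > 1\<close> by (intro mult_right_mono) auto
    then show ?thesis
      using I(2)[OF that] by linarith
  qed
  have Hp: "Hp p \<in> borel_measurable (F p)" if "p \<in> I" for p
    unfolding Hp_def[abs_def] using S_adapted[of p] measurable_F_mono[OF H p0[OF that]] by measurable
  have "(\<integral>\<^sup>+\<omega>. H \<omega> * (\<Sum>p\<in>I. \<Sum>q\<in>{q\<in>I. p \<le> q}. indicator (ball x e) (S p \<omega>) * indicator (ball y e) (S q \<omega>)) \<partial>M)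
      = (\<Sum>p\<in>I. \<Sum>q\<in>{q\<in>I. p \<le> q}. \<integral>\<^sup>+\<omega>. Hp p \<omega> * indicator (ball y e) (S q \<omega>) \<partial>M)"
    unfolding Hp_def by (simp add: sum_distrib_left nn_integral_sum mult.assoc)
  also have "\<dots> \<le> (\<Sum>p\<in>I. \<Sum>q\<in>{q\<in>I. p \<le> q}. ennreal (g (q - p)) * (\<integral>\<^sup>+\<omega>. Hp p \<omega> \<partial>M))"
    by (intro sum_mono g Hp) (auto simp: Hp_def indicator_def split: if_splits)
  also have "\<dots> = (\<Sum>p\<in>I. ennreal (\<Sum>q\<in>{q\<in>I. p \<le> q}. g (q - p)) * (\<integral>\<^sup>+\<omega>. Hp p \<omega> \<partial>M))"
    using g_nonneg by (simp add: sum_distrib_right[symmetric] sum_ennreal)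
  also have "\<dots> \<le> (\<Sum>p\<in>I. ennreal G * (\<integral>\<^sup>+\<omega>. Hp p \<omega> \<partial>M))"
    by (intro sum_mono mult_right_mono ennreal_leI G) auto
  also have "\<dots> = ennreal G * (\<integral>\<^sup>+\<omega>. H \<omega> * hits I x e \<omega> \<partial>M)"
    unfolding hits_def Hp_def by (simp add: sum_distrib_left nn_integral_sum)
  also have "\<dots> \<le> ennreal G * (ennreal (B / (B - 1) * weight I e) * (\<integral>\<^sup>+\<omega>. H \<omega> \<partial>M))"
    using assms by (intro mult_left_mono window_le) auto
  also have "\<dots> = ennreal (B / (B - 1) * weight I e * G) * (\<integral>\<^sup>+\<omega>. H \<omega> \<partial>M)"
    unfolding mult.assoc[symmetric] using weight_nonneg[of I e] \<open>B > 1\<close> G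
    by (subst ennreal_mult[symmetric]) (auto simp: mult_ac)
  finally show ?thesis .
qed

text \<open>The pairs of times are split by which disc is visited first, giving the factor
  \<open>2\<close>; hence \<open>g\<close> has to serve both orders of the centres. Simultaneous
  visits are counted twice, which an upper bound allows.\<close>

lemma window_pair_le:
  assumes H: "H \<in> borel_measurable (F p0)" and e: "e \<ge> 0" and B: "B > 1"
    and I: "finite I" "\<And>p. p \<in> I \<Longrightarrow> B * real p0 \<le> real p \<and> p > 0"
    and g_nonneg: "\<And>u. g u \<ge> 0"
    and g: "\<And>x' y' p q H. {x', y'} = {x, y} \<Longrightarrow> p \<in> I \<Longrightarrow> q \<in> I \<Longrightarrow> p \<le> q \<Longrightarrow> H \<in> borel_measurable (F p) \<Longrightarrow>
      (\<And>\<omega>. H \<omega> \<noteq> 0 \<Longrightarrow> S p \<omega> \<in> ball x' e) \<Longrightarrow>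
      (\<integral>\<^sup>+\<omega>. H \<omega> * indicator (ball y' e) (S q \<omega>) \<partial>M) \<le> ennreal (g (q - p)) * (\<integral>\<^sup>+\<omega>. H \<omega> \<partial>M)"
    and G: "\<And>p. p \<in> I \<Longrightarrow> (\<Sum>q\<in>{q\<in>I. p \<le> q}. g (q - p)) \<le> G" "G \<ge> 0"
  shows "(\<integral>\<^sup>+\<omega>. H \<omega> * (hits I x e \<omega> * hits I y e \<omega>) \<partial>M)
    \<le> ennreal (2 * (B / (B - 1) * weight I e * G)) * (\<integral>\<^sup>+\<omega>. H \<omega> \<partial>M)"
proof -
  note [measurable] = measurable_F_M[OF H]
  define P where "P = (\<lambda>x y \<omega>. \<Sum>p\<in>I. \<Sum>q\<in>{q\<in>I. p \<le> q}. indicator (ball x e) (S p \<omega>) * indicator (ball y e) (S q \<omega>) :: ennreal)"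
  have [measurable]: "P x y \<in> borel_measurable M" for x y
    unfolding P_def by measurable
  have "hits I x e \<omega> * hits I y e \<omega> \<le> P x y \<omega> + P y x \<omega>" for \<omega>
  proof -
    define a where "a p = (indicator (ball x e) (S p \<omega>) :: ennreal)" for p
    define b where "b p = (indicator (ball y e) (S p \<omega>) :: ennreal)" for p
    have "hits I x e \<omega> * hits I y e \<omega> = (\<Sum>p\<in>I. \<Sum>q\<in>I. a p * b q)"
      by (simp add: hits_def a_def b_def sum_product)
    also have "\<dots> \<le> (\<Sum>p\<in>I. (\<Sum>q\<in>{q\<in>I. p \<le> q}. a p * b q) + (\<Sum>q\<in>{q\<in>I. q \<le> p}. a p * b q))"
    proof (intro sum_mono)
      fix p
      have "(\<Sum>q\<in>I. a p * b q) = (\<Sum>q\<in>{q\<in>I. p \<le> q} \<union> {q\<in>I. q \<le> p}. a p * b q)"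
        by (intro sum.cong) auto
      also have "\<dots> \<le> (\<Sum>q\<in>{q\<in>I. p \<le> q}. a p * b q) + (\<Sum>q\<in>{q\<in>I. q \<le> p}. a p * b q)"
        by (subst sum.union_inter[symmetric]) (auto simp: I(1) intro!: add_increasing2)
      finally show "(\<Sum>q\<in>I. a p * b q) \<le> (\<Sum>q\<in>{q\<in>I. p \<le> q}. a p * b q) + (\<Sum>q\<in>{q\<in>I. q \<le> p}. a p * b q)" .
    qed
    also have "\<dots> = (\<Sum>p\<in>I. \<Sum>q\<in>{q\<in>I. p \<le> q}. a p * b q) + (\<Sum>q\<in>I. \<Sum>p\<in>{p\<in>I. q \<le> p}. a p * b q)"
      unfolding sum.distrib using sum.swap_restrict[OF I(1) I(1), of "\<lambda>p q. a p * b q" "\<lambda>p q. q \<le> p"] by simp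
    also have "\<dots> = P x y \<omega> + P y x \<omega>"
      by (simp add: P_def a_def b_def mult.commute)
    finally show ?thesis .
  qed
  then have "(\<integral>\<^sup>+\<omega>. H \<omega> * (hits I x e \<omega> * hits I y e \<omega>) \<partial>M) \<le> (\<integral>\<^sup>+\<omega>. H \<omega> * P x y \<omega> + H \<omega> * P y x \<omega> \<partial>M)"
    by (intro nn_integral_mono) (auto simp: distrib_left[symmetric] intro!: mult_left_mono)
  also have "\<dots> = (\<integral>\<^sup>+\<omega>. H \<omega> * P x y \<omega> \<partial>M) + (\<integral>\<^sup>+\<omega>. H \<omega> * P y x \<omega> \<partial>M)"
    by (intro nn_integral_add) measurable
  also have "\<dots> \<le> ennreal (B / (B - 1) * weight I e * G) * (\<integral>\<^sup>+\<omega>. H \<omega> \<partial>M)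
      + ennreal (B / (B - 1) * weight I e * G) * (\<integral>\<^sup>+\<omega>. H \<omega> \<partial>M)"
    unfolding P_def
    by (intro add_mono; rule window_ordered_pair_le[where g = g, OF H e B I g_nonneg])
       (auto intro: g G)
  also have "\<dots> = ennreal (2 * (B / (B - 1) * weight I e * G)) * (\<integral>\<^sup>+\<omega>. H \<omega> \<partial>M)"
    using weight_nonneg[of I e] B G
    by (simp only: distrib_right[symmetric] mult_2, subst ennreal_plus[symmetric]) (auto simp: mult_ac)
  finally show ?thesis .
qed

end

section \<open>Elementary sums\<close>

lemma ln_le_sum_inverse:
  assumes "0 < a" "a \<le> b"
  shows "ln (real b / real a) \<le> (\<Sum>p=a..b. 1 / real p)"
proof -
  \<comment> \<open>Replacing \<open>b\<close> by \<open>b + 1\<close> makes the induction close: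
    the logarithm grows by \<open>ln (1 + 1 / (b + 1)) \<le> 1 / (b + 1)\<close>.\<close>
  have "ln ((real b + 1) / real a) \<le> (\<Sum>p=a..b. 1 / real p)"
    using assms(2)
  proof (induction b rule: dec_induct)
    case base
    have "ln ((real a + 1) / real a) = ln (1 + 1 / real a)"
      using assms(1) by (simp add: field_simps)
    then show ?case
      using ln_add_one_self_le_self[of "1 / real a"] assms(1) by simp
  next
    case (step b)
    have b: "real b + 1 > 0" "real a > 0"
      using assms(1) by auto
    have "real (Suc b) + 1 = (real b + 1) * (1 + 1 / (real b + 1))"
      using b by (simp add: distrib_left)
    then have "(real (Suc b) + 1) / real a = ((real b + 1) / real a) * (1 + 1 / (real b + 1))"
      by simp
    then have "ln ((real (Suc b) + 1) / real a) = ln ((real b + 1) / real a) + ln (1 + 1 / (real b + 1))"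
      using b by (simp only: ln_mult_pos divide_pos_pos add_pos_pos zero_less_one)
    also have "\<dots> \<le> (\<Sum>p=a..b. 1 / real p) + 1 / (real b + 1)"
      using step.IH b by (intro add_mono ln_add_one_self_le_self) auto
    also have "\<dots> = (\<Sum>p=a..Suc b. 1 / real p)"
      using step.hyps by (simp add: add.commute)
    finally show ?case .
  qed
  moreover have "ln (real b / real a) \<le> ln ((real b + 1) / real a)"
    using assms by (intro ln_mono divide_right_mono) auto
  ultimately show ?thesis
    by linarith
qed

lemma sum_inverse_le_ln:
  assumes "0 < a" "a \<le> b"
  shows "(\<Sum>p=Suc a..b. 1 / real p) \<le> ln (real b / real a)"
  using assms(2)
proof (induction b rule: dec_induct)
  case base
  then show ?case
    using assms by simp
next
  case (step b)
  have b: "real b > 0" "real a > 0"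
    using assms(1) step.hyps by auto
  have "ln (real b / real (Suc b)) \<le> real b / real (Suc b) - 1"
    using b by (intro ln_le_minus_one) auto
  also have "\<dots> = - (1 / real (Suc b))"
    by (simp add: field_simps)
  finally have "1 / real (Suc b) \<le> ln (real (Suc b)) - ln (real b)"
    using b by (simp add: ln_div)
  moreover have "(\<Sum>p=Suc a..Suc b. 1 / real p) = (\<Sum>p=Suc a..b. 1 / real p) + 1 / real (Suc b)"
    using step.hyps by simp
  ultimately show ?case
    using step.IH b by (simp add: ln_div)
qed

lemma sum_inverse_sqrt_le: "(\<Sum>d=1..m. 1 / sqrt (real d)) \<le> 2 * sqrt (real m)"
proof (induction m)
  case (Suc m)
  have "1 / sqrt (real (Suc m)) \<le> 2 * (sqrt (real (Suc m)) - sqrt (real m))"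
  proof -
    define a b where "a = sqrt (real (Suc m))" and "b = sqrt (real m)"
    have ab: "a > 0" "b \<ge> 0" "b \<le> a" "a\<^sup>2 = b\<^sup>2 + 1"
      by (auto simp: a_def b_def)
    have "1 = (a - b) * (a + b)"
      using ab by (simp add: power2_eq_square algebra_simps)
    also have "\<dots> \<le> (a - b) * (2 * a)"
      using ab by (intro mult_left_mono) auto
    finally have "1 / a \<le> 2 * (a - b)"
      using ab by (simp add: field_simps)
    then show ?thesis
      by (simp add: a_def b_def)
  qed
  then show ?case
    using Suc by simp
qed simp

text \<open>Distance of two directions in units of the mesh, cut off at \<open>1\<close> because
  distances inside one disc are not resolved; \<open>real m / gap i j\<close> thus never divides by
  zero.\<close>

definition gap :: "nat \<Rightarrow> nat \<Rightarrow> real" where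
  "gap i j = max 1 \<bar>real i - real j\<bar>"

text \<open>A Riemann sum of the integrable singularity \<open>|x|^(-1/2)\<close>: each side of
  \<open>i\<close> contributes at most \<open>2 m\<close> and the diagonal term at most
  \<open>m\<close>.\<close>

lemma sum_sqrt_gap_le:
  assumes "i < m"
  shows "(\<Sum>j<m. sqrt (real m / gap i j)) \<le> 5 * real m"
proof -
  define f where "f d = sqrt (real m / max 1 (real d))" for d :: nat
  have "(\<Sum>j<m. sqrt (real m / gap i j))
      = (\<Sum>j\<in>{..<i}. sqrt (real m / gap i j)) + (\<Sum>j\<in>{i..<m}. sqrt (real m / gap i j))"
    using assms by (simp add: lessThan_atLeast0 sum.atLeastLessThan_concat)
  also have "\<dots> = (\<Sum>j\<in>{..<i}. f (i - j)) + (\<Sum>j\<in>{i..<m}. f (j - i))"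
    by (intro arg_cong2[where f = "(+)"] sum.cong) (auto simp: f_def gap_def of_nat_diff abs_if)
  also have "(\<Sum>j\<in>{..<i}. f (i - j)) \<le> (\<Sum>d=1..m. f d)"
  proof -
    have "(\<Sum>j\<in>{..<i}. f (i - j)) = (\<Sum>d\<in>(\<lambda>j. i - j) ` {..<i}. f d)"
      by (subst sum.reindex) (auto simp: inj_on_def)
    also have "\<dots> \<le> (\<Sum>d=1..m. f d)"
      using assms by (intro sum_mono2) (auto simp: f_def)
    finally show ?thesis .
  qed
  also have "(\<Sum>j\<in>{i..<m}. f (j - i)) \<le> f 0 + (\<Sum>d=1..m. f d)"
  proof -
    have "(\<Sum>j\<in>{i..<m}. f (j - i)) = (\<Sum>d\<in>(\<lambda>j. j - i) ` {i..<m}. f d)"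
      by (subst sum.reindex) (auto simp: inj_on_def)
    also have "\<dots> \<le> (\<Sum>d\<in>{0..m}. f d)"
      using assms by (intro sum_mono2) (auto simp: f_def)
    also have "\<dots> = f 0 + (\<Sum>d=1..m. f d)"
      by (simp add: sum.atLeast_Suc_atMost)
    finally show ?thesis .
  qed
  also have "(\<Sum>d=1..m. f d) = sqrt (real m) * (\<Sum>d=1..m. 1 / sqrt (real d))"
    unfolding sum_distrib_left by (intro sum.cong) (auto simp: f_def real_sqrt_divide max_def)
  also have "\<dots> \<le> sqrt (real m) * (2 * sqrt (real m))"
    by (intro mult_left_mono sum_inverse_sqrt_le) auto
  also have "\<dots> = 2 * real m"
    by simp
  also have "f 0 = sqrt (real m)"
    by (simp add: f_def)
  also have "sqrt (real m) \<le> real m"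
    using assms by (intro real_le_lsqrt) (auto simp: power2_eq_square)
  finally show ?thesis
    by simp
qed

section \<open>Windows and targets\<close>

text \<open>For \<open>s\<close> in \<open>[0, 1]\<close>, a quarter of the unit circle parametrised
  by the first coordinate: projecting onto that coordinate bounds distances from below by
  differences of parameters.\<close>

definition arc_dir :: "real \<Rightarrow> real ^ 2" where
  "arc_dir s = vector [s, sqrt (1 - s\<^sup>2)]"

lemma norm_arc_dir: "0 \<le> s \<Longrightarrow> s \<le> 1 \<Longrightarrow> norm (arc_dir s) = 1"
  by (simp add: arc_dir_def norm_vec_def L2_set_def sum_2 power_le_one)

lemma dist_arc_dir: "dist (arc_dir s) (arc_dir t) \<ge> \<bar>s - t\<bar>"
  using component_le_norm_cart[of "arc_dir s - arc_dir t" 1]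
  by (simp add: arc_dir_def dist_norm)

text \<open>The \<open>k\<close>-th window is \<open>[a, a\<^sup>2]\<close> with \<open>a = win_lo B k\<close>, so consecutive windows are a factor \<open>B\<close> apart.\<close>

fun win_lo :: "nat \<Rightarrow> nat \<Rightarrow> nat" where
  "win_lo B 0 = B"
| "win_lo B (Suc k) = B * (win_lo B k)\<^sup>2"

lemma win_lo_ge: "B > 0 \<Longrightarrow> B \<le> win_lo B k"
  by (induction k) (auto simp: power2_eq_square)

lemma win_lo_mono:
  assumes "B > 0" "k \<le> l"
  shows "win_lo B k \<le> win_lo B l"
  using assms(2)
proof (induction l rule: dec_induct)
  case (step l)
  have "win_lo B l * 1 \<le> win_lo B l * (B * win_lo B l)"
    using win_lo_ge[of B l] assms(1) by (intro mult_left_mono) auto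
  also have "\<dots> = win_lo B (Suc l)"
    by (simp add: power2_eq_square mult_ac)
  finally show ?case
    using step.IH by simp
qed simp

text \<open>With \<open>e = r / (4 m)\<close> neighbouring targets are at least \<open>4 e\<close>
  apart. \<open>h = 1 / L\<close> puts integer times on the grid, and \<open>h \<le> e^2\<close>
  makes the grid finer than the diffusive time scale of a disc. \<open>B \<ge> 3\<close> gives
  window starts with logarithm at least \<open>1\<close>; \<open>B \<ge> 16 / r^2\<close> lets these
  logarithms absorb the factor \<open>16 / r^2\<close> that arises from \<open>e^2\<close>.\<close>

locale arc_targets = planar_gaussian_walk M F S h
  for M :: "'a measure" and F S h +
  fixes n m L B :: nat and r e :: real
  assumes n: "n \<ge> 1" and m: "m \<ge> 1" and L: "L \<ge> 1" and r: "r > 0"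
    and e_eq: "e = r / (4 * real m)" and h_eq: "h = 1 / real L" and h_le: "h \<le> e\<^sup>2"
    and B_ge: "real B \<ge> 3" "real B \<ge> 16 / r\<^sup>2"
begin

definition window :: "nat \<Rightarrow> nat set" where
  "window k = {win_lo B k * L .. (win_lo B k)\<^sup>2 * L}"

text \<open>Windows are numbered consecutively through all blocks of \<open>n\<close>; the one at
  position \<open>l\<close> of its block, counted from \<open>0\<close>, aims at point number
  \<open>l + 1\<close> of the progression in direction \<open>i\<close>.\<close>

definition target :: "nat \<Rightarrow> nat \<Rightarrow> real ^ 2" where
  "target k i = ((real (k mod n) + 1) * r) *\<^sub>R arc_dir (real i / real m)"

lemma e_pos: "e > 0"
  using r m by (simp add: e_eq)

lemma win_lo_ge_B: "real (win_lo B k) \<ge> real B"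
  using win_lo_ge[of B k] B_ge by simp

lemma win_lo_ge_3: "real (win_lo B k) \<ge> 3"
  using win_lo_ge_B[of k] B_ge by linarith

lemma ln_win_lo: "ln (real (win_lo B k)) \<ge> 1" "ln (real (win_lo B k)) \<ge> ln (16 / r\<^sup>2)"
proof -
  have "exp 1 \<le> real (win_lo B k)"
    using exp_le win_lo_ge_3[of k] by linarith
  then show "ln (real (win_lo B k)) \<ge> 1"
    using win_lo_ge_3[of k] by (subst ln_ge_iff) auto
  show "ln (real (win_lo B k)) \<ge> ln (16 / r\<^sup>2)"
    using win_lo_ge_B[of k] B_ge r by (intro ln_mono) auto
qed

text \<open>The harmonic sum is at least the logarithm of the ratio of the end points of the window,
  and this ratio is \<open>win_lo B k\<close> itself: the refinement \<open>L\<close>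
  cancels.\<close>

lemma weight_window_ge: "weight (window k) e \<ge> e\<^sup>2 / (2 * h) * ln (real (win_lo B k))"
proof -
  define a where "a = win_lo B k"
  have a: "a \<ge> 3"
    using win_lo_ge_3[of k] by (simp add: a_def)
  have "ln (real (a\<^sup>2 * L) / real (a * L)) \<le> (\<Sum>p=a * L..a\<^sup>2 * L. 1 / real p)"
    using a L by (intro ln_le_sum_inverse) (auto simp: power2_eq_square)
  also have "real (a\<^sup>2 * L) / real (a * L) = real a"
    using a L by (simp add: power2_eq_square)
  finally have "e\<^sup>2 / (2 * h) * ln (real a) \<le> e\<^sup>2 / (2 * h) * (\<Sum>p=a * L..a\<^sup>2 * L. 1 / real p)"
    using h_pos by (intro mult_left_mono) auto
  also have "\<dots> = weight (window k) e"
    unfolding weight_def window_def a_def sum_distrib_left by (intro sum.cong) (auto simp: mult_ac)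
  finally show ?thesis
    by (simp add: a_def)
qed

lemma weight_window_pos: "weight (window k) e > 0"
proof -
  have "0 < e\<^sup>2 / (2 * h) * ln (real (win_lo B k))"
    using e_pos h_pos ln_win_lo(1)[of k] by (intro mult_pos_pos divide_pos_pos) auto
  then show ?thesis
    using weight_window_ge[of k] by linarith
qed

lemma gap_ge_1: "gap i j \<ge> 1"
  by (simp add: gap_def)

lemma gap_commute: "gap i j = gap j i"
  by (simp add: gap_def abs_minus_commute)

lemma gap_le_m: "i < m \<Longrightarrow> j < m \<Longrightarrow> gap i j \<le> real m"
  by (auto simp: gap_def abs_if)

lemma dist_target: "dist (target k i) (target k j) \<ge> 4 * e * \<bar>real i - real j\<bar>"
proof -
  have "4 * e * \<bar>real i - real j\<bar> = 1 * r * \<bar>real i / real m - real j / real m\<bar>"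
    using m by (simp add: e_eq diff_divide_distrib[symmetric] abs_divide)
  also have "\<dots> \<le> (real (k mod n) + 1) * r * dist (arc_dir (real i / real m)) (arc_dir (real j / real m))"
    using r by (intro mult_mono dist_arc_dir) auto
  also have "\<dots> = dist (target k i) (target k j)"
    using r by (simp add: target_def dist_norm scaleR_diff_right[symmetric])
  finally show ?thesis .
qed

text \<open>
  An upper bound for the probability that the walk, standing in the \<open>i\<close>-th disc, is in the \<open>j\<close>-th one
  \<open>u\<close> steps later. The case \<open>i = j\<close> is covered by \<^const>\<open>gap\<close> being at least \<open>1\<close>.
\<close>

definition kern :: "nat \<Rightarrow> nat \<Rightarrow> nat \<Rightarrow> real" where
  "kern i j u = (if real u * h \<le> e\<^sup>2 * (gap i j)\<^sup>2 then 1 / (gap i j)\<^sup>2 else e\<^sup>2 / (2 * (real u * h)))"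

lemma kern_nonneg: "kern i j u \<ge> 0"
  using h_pos by (simp add: kern_def)

text \<open>Long lags use the disc bound. For short lags \<open>i = j\<close> leaves only the
  trivial bound \<open>1\<close>; otherwise the discs are separated and \<open>step_le_far\<close>
  is uniform in the lag. At lag \<open>0\<close> separated discs are disjoint.\<close>

lemma step_le_kern:
  assumes "p \<le> q" and H: "H \<in> borel_measurable (F p)"
    and supp: "\<And>\<omega>. H \<omega> \<noteq> 0 \<Longrightarrow> S p \<omega> \<in> ball (target k i) e"
  shows "(\<integral>\<^sup>+\<omega>. H \<omega> * indicator (ball (target k j) e) (S q \<omega>) \<partial>M)
    \<le> ennreal (kern i j (q - p)) * (\<integral>\<^sup>+\<omega>. H \<omega> \<partial>M)"
proof (cases "real (q - p) * h \<le> e\<^sup>2 * (gap i j)\<^sup>2")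
  case False
  then have "p < q"
    using \<open>p \<le> q\<close> by (cases "p = q") (auto simp: not_le)
  with False show ?thesis
    using step_le_disc[OF _ H, of q e] e_pos by (simp add: kern_def)
next
  case True
  note near = True
  show ?thesis
  proof (cases "i = j")
    case True
    have "(\<integral>\<^sup>+\<omega>. H \<omega> * indicator (ball (target k j) e) (S q \<omega>) \<partial>M) \<le> (\<integral>\<^sup>+\<omega>. H \<omega> \<partial>M)"
      by (intro nn_integral_mono) (auto simp: indicator_def)
    with True near show ?thesis
      by (simp add: kern_def gap_def)
  next
    case False
    have gap_eq: "gap i j = \<bar>real i - real j\<bar>"
      using False by (auto simp: gap_def max_def abs_if)
    \<comment> \<open>Of the separation \<open>4 * e * gap i j\<close>, half serves as
      \<open>d\<close> in \<open>step_le_far\<close>; the other half pays for the two radii, as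
      \<open>gap i j \<ge> 1\<close>.\<close>
    have far: "dist (target k i) (target k j) \<ge> 2 * e * gap i j + 2 * e"
    proof -
      have "2 * e * 1 \<le> 2 * e * gap i j"
        using e_pos gap_ge_1 by (intro mult_left_mono) auto
      then show ?thesis
        using dist_target[of i j k] by (simp add: gap_eq)
    qed
    show ?thesis
    proof (cases "p = q")
      case True
      have "H \<omega> * indicator (ball (target k j) e) (S q \<omega>) = 0" for \<omega>
      proof (rule ccontr)
        assume "\<not> ?thesis"
        then have "S q \<omega> \<in> ball (target k i) e" "S q \<omega> \<in> ball (target k j) e"
          using supp[of \<omega>] True by (auto simp: indicator_def split: if_splits)
        then have "dist (target k i) (target k j) < 2 * e"
          using dist_triangle[of "target k i" "target k j" "S q \<omega>"] by (simp add: dist_commute)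
        moreover have "2 * e * gap i j \<ge> 0"
          using e_pos gap_ge_1[of i j] by simp
        ultimately show False
          using far by linarith
      qed
      then show ?thesis
        by (simp only:) simp
    next
      case pq: False
      have "e\<^sup>2 / (2 * e * gap i j)\<^sup>2 \<le> 1 / (gap i j)\<^sup>2"
        using e_pos gap_ge_1[of i j] by (simp add: power_mult_distrib divide_simps)
      moreover have "2 * e * gap i j > 0"
        using e_pos gap_ge_1[of i j] by simp
      ultimately show ?thesis
        using step_le_far[OF _ H, of q e "2 * e * gap i j" "target k i" "target k j"] far supp e_pos pq \<open>p \<le> q\<close> near
        by (auto simp: kern_def intro: order_trans intro!: mult_right_mono ennreal_leI)
    qed
  qed
qed

text \<open>Up to the lag \<open>x = e^2 D^2 / h\<close> at which \<open>kern\<close> changes form,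
  the sum is of order \<open>e^2 / h\<close>. Beyond it a harmonic sum gives
  \<open>e^2 / (2 h)\<close> times the logarithm of the window end over \<open>x\<close>, which
  splits into multiples of \<open>ln (win_lo B k)\<close> and \<open>ln (m / D)\<close>. Dividing by
  \<open>weight\<close> leaves only the latter.\<close>

lemma sum_kern_le:
  assumes ij: "i < m" "j < m"
  shows "(\<Sum>u\<le>(win_lo B k)\<^sup>2 * L. kern i j u) \<le> weight (window k) e * (8 + 2 * ln (real m / gap i j))"
proof -
  define b where "b = (win_lo B k)\<^sup>2 * L"
  define D where "D = gap i j"
  define x where "x = e\<^sup>2 * D\<^sup>2 / h"
  define c where "c = nat \<lfloor>x\<rfloor>"
  define l where "l = ln (real (win_lo B k))"
  have D: "D \<ge> 1" "D \<le> real m"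
    using gap_ge_1 gap_le_m ij by (auto simp: D_def)
  have "e\<^sup>2 * 1 \<le> e\<^sup>2 * D\<^sup>2"
    using D e_pos by (intro mult_left_mono) auto
  then have x: "x \<ge> 1"
    using h_le h_pos by (simp add: x_def)
  have c: "c \<ge> 1" "real c \<le> x" "x < real c + 1"
    using x by (auto simp: c_def le_nat_floor)
  have c2: "x / 2 \<le> real c"
    using c by linarith
  have kern_eq: "kern i j u = (if u \<le> c then 1 / D\<^sup>2 else e\<^sup>2 / (2 * h) * (1 / real u))" for u
  proof -
    have "real u * h \<le> e\<^sup>2 * (gap i j)\<^sup>2 \<longleftrightarrow> real u \<le> x"
      using h_pos by (simp add: x_def D_def field_simps)
    also have "\<dots> \<longleftrightarrow> u \<le> c"
      using x by (simp add: c_def le_nat_iff le_floor_iff)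
    finally show ?thesis
      by (simp add: kern_def D_def)
  qed
  have v: "ln (real m / D) \<ge> 0"
    using D by simp
  have l: "l \<ge> 1" "l \<ge> ln (16 / r\<^sup>2)"
    using ln_win_lo[of k] by (auto simp: l_def)
  have tail: "(\<Sum>u=Suc c..b. 1 / real u) \<le> 4 * l + 2 * ln (real m / D)"
  proof (cases "c \<le> b")
    case False
    then show ?thesis
      using v l by simp
  next
    case True
    have pos: "real (win_lo B k) > 0" "real L > 0"
      using win_lo_ge_3[of k] L by auto
    have "(\<Sum>u=Suc c..b. 1 / real u) \<le> ln (real b / real c)"
      using c True by (intro sum_inverse_le_ln) auto
    also have "\<dots> \<le> ln (real b / (x / 2))"
      using c c2 x True by (intro ln_mono divide_left_mono mult_pos_pos divide_pos_pos) auto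
    \<comment> \<open>Inserting \<open>e = r / (4 m)\<close> and \<open>h = 1 / L\<close> cancels
      \<open>L\<close>; the logarithms of the factors are then treated separately,
      \<open>ln 2\<close> and \<open>ln (16 / r^2)\<close> being at most \<open>l\<close>
      each.\<close>
    also have "real b / (x / 2) = 2 * (real (win_lo B k) * real (win_lo B k)) * (16 / r\<^sup>2) * ((real m / D) * (real m / D))"
      using D pos r m by (simp add: x_def b_def h_eq e_eq field_simps power2_eq_square)
    also have "ln \<dots> = ln 2 + (l + l) + ln (16 / r\<^sup>2) + (ln (real m / D) + ln (real m / D))"
    proof -
      have p: "0 < real (win_lo B k)" "0 < 16 / r\<^sup>2" "0 < real m / D"
        using pos r D m by auto
      then have q: "0 < real (win_lo B k) * real (win_lo B k)" "0 < (real m / D) * (real m / D)"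
        by (auto intro!: mult_pos_pos simp del: times_divide_eq_left times_divide_eq_right times_divide_times_eq)
      show ?thesis
        unfolding l_def using p q
        by (simp only: ln_mult_pos mult_pos_pos zero_less_numeral)
    qed
    also have "\<dots> \<le> 4 * l + 2 * ln (real m / D)"
      using l ln_2_less_1 by linarith
    finally show ?thesis .
  qed
  have "(\<Sum>u\<le>b. kern i j u) \<le> (\<Sum>u\<in>{..c} \<union> {Suc c..b}. kern i j u)"
    by (intro sum_mono2) (auto simp: kern_nonneg)
  also have "\<dots> = (\<Sum>u\<le>c. kern i j u) + (\<Sum>u=Suc c..b. kern i j u)"
    by (intro sum.union_disjoint) auto
  also have "(\<Sum>u\<le>c. kern i j u) = (real c + 1) / D\<^sup>2"
    by (simp add: kern_eq)
  also have "\<dots> \<le> (2 * x) / D\<^sup>2"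
    using c x by (intro divide_right_mono) auto
  also have "\<dots> = e\<^sup>2 / (2 * h) * 4"
    using D by (simp add: x_def)
  also have "(\<Sum>u=Suc c..b. kern i j u) = e\<^sup>2 / (2 * h) * (\<Sum>u=Suc c..b. 1 / real u)"
    unfolding sum_distrib_left by (intro sum.cong) (auto simp: kern_eq)
  also have "\<dots> \<le> e\<^sup>2 / (2 * h) * (4 * l + 2 * ln (real m / D))"
    using h_pos by (intro mult_left_mono tail) auto
  finally have "(\<Sum>u\<le>b. kern i j u) \<le> e\<^sup>2 / (2 * h) * (4 + 4 * l + 2 * ln (real m / D))"
    by (simp only: distrib_left[symmetric] add.assoc)
  also have "\<dots> \<le> e\<^sup>2 / (2 * h) * (l * (8 + 2 * ln (real m / D)))"
  proof (intro mult_left_mono)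
    \<comment> \<open>\<open>l \<ge> 1\<close> lets all terms be multiplied by \<open>l\<close>, the
      factor that \<open>weight_window_ge\<close> supplies.\<close>
    have "1 * (2 * ln (real m / D)) \<le> l * (2 * ln (real m / D))"
      using v l by (intro mult_right_mono) auto
    then show "4 + 4 * l + 2 * ln (real m / D) \<le> l * (8 + 2 * ln (real m / D))"
      using l by (simp add: distrib_left)
  qed (use h_pos in auto)
  also have "\<dots> \<le> weight (window k) e * (8 + 2 * ln (real m / D))"
    unfolding mult.assoc[symmetric] using weight_window_ge[of k] v
    by (intro mult_right_mono) (auto simp: l_def)
  finally show ?thesis
    by (simp add: b_def D_def)
qed

text \<open>Dividing by \<open>weight\<close> brings the mean close to \<open>1\<close> for large
  \<open>B\<close>, for every window and direction; products over windows then stay comparable with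
  \<open>1\<close>.\<close>

definition visits :: "nat \<Rightarrow> nat \<Rightarrow> 'a \<Rightarrow> ennreal" where
  "visits k i \<omega> = ennreal (1 / weight (window k) e) * hits (window k) (target k i) e \<omega>"

text \<open>The grid index at which the preceding window ends, \<open>0\<close> if there is none:
  everything before window \<open>k\<close> is known at \<open>start k\<close>.\<close>

definition start :: "nat \<Rightarrow> nat" where
  "start k = (case k of 0 \<Rightarrow> 0 | Suc l \<Rightarrow> (win_lo B l)\<^sup>2 * L)"

lemma start_Suc: "start (Suc k) = (win_lo B k)\<^sup>2 * L"
  by (simp add: start_def)

lemma window_start: "p \<in> window k \<Longrightarrow> real B * real (start k) \<le> real p \<and> p > 0"
proof -
  assume p: "p \<in> window k"
  have "B * start k \<le> win_lo B k * L"
    by (cases k) (auto simp: start_def)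
  also have "\<dots> \<le> p"
    using p by (simp add: window_def)
  finally have "real (B * start k) \<le> real p"
    by (simp only: of_nat_le_iff)
  moreover have "0 < win_lo B k * L"
    using win_lo_ge_3[of k] L by simp
  ultimately show ?thesis
    using p unfolding window_def atLeastAtMost_iff of_nat_mult by linarith
qed

lemma start_le_Suc: "start k \<le> start (Suc k)"
proof -
  define p where "p = win_lo B k * L"
  have "p \<in> window k"
    using win_lo_ge_3[of k] by (auto simp: p_def window_def power2_eq_square)
  then have "1 * real (start k) \<le> real B * real (start k)" "real B * real (start k) \<le> real p" "p \<le> start (Suc k)"
    using window_start[of p k] B_ge by (auto simp: window_def start_Suc intro: mult_right_mono[of 1 "real B" "real (start k)", simplified])
  then show ?thesis
    by linarith
qed

lemma visits_measurable_F: "visits k i \<in> borel_measurable (F (start (Suc k)))"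
proof -
  have "hits (window k) (target k i) e \<in> borel_measurable (F (start (Suc k)))"
    by (rule hits_measurable_F) (simp add: window_def start_Suc)
  then show ?thesis
    unfolding visits_def[abs_def] by measurable
qed

lemma visits_measurable [measurable]: "visits k i \<in> borel_measurable M"
  by (rule measurable_F_M[OF visits_measurable_F])

lemma ennreal_weight_cancel: "ennreal (1 / weight (window k) e) * ennreal (c * weight (window k) e) = ennreal c" if "c \<ge> 0"
  using that weight_window_pos[of k] by (simp add: ennreal_mult[symmetric])

lemma visits_le:
  assumes H: "H \<in> borel_measurable (F (start k))"
  shows "(\<integral>\<^sup>+\<omega>. H \<omega> * visits k i \<omega> \<partial>M) \<le> ennreal (real B / (real B - 1)) * (\<integral>\<^sup>+\<omega>. H \<omega> \<partial>M)"
proof -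
  note [measurable] = measurable_F_M[OF H]
  have "(\<integral>\<^sup>+\<omega>. H \<omega> * visits k i \<omega> \<partial>M)
      = ennreal (1 / weight (window k) e) * (\<integral>\<^sup>+\<omega>. H \<omega> * hits (window k) (target k i) e \<omega> \<partial>M)"
    unfolding visits_def by (subst nn_integral_cmult[symmetric]) (auto simp: mult_ac)
  also have "\<dots> \<le> ennreal (1 / weight (window k) e) * (ennreal (real B / (real B - 1) * weight (window k) e) * (\<integral>\<^sup>+\<omega>. H \<omega> \<partial>M))"
    using e_pos B_ge window_start by (intro mult_left_mono window_le[OF H]) auto
  also have "\<dots> = ennreal (real B / (real B - 1)) * (\<integral>\<^sup>+\<omega>. H \<omega> \<partial>M)"
    unfolding mult.assoc[symmetric] using B_ge by (subst ennreal_weight_cancel) auto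
  finally show ?thesis .
qed

text \<open>The factor \<open>4\<close> collects the \<open>2\<close> for the two orders of visits
  and the bound \<open>2\<close> for \<open>B / (B - 1)\<close>; the rest comes from
  \<open>sum_kern_le\<close>.\<close>

definition pair_bound :: "nat \<Rightarrow> nat \<Rightarrow> real" where
  "pair_bound i j = 4 * (8 + 2 * ln (real m / gap i j))"

lemma visits_pair_le:
  assumes H: "H \<in> borel_measurable (F (start k))" and ij: "i < m" "j < m"
  shows "(\<integral>\<^sup>+\<omega>. H \<omega> * (visits k i \<omega> * visits k j \<omega>) \<partial>M) \<le> ennreal (pair_bound i j) * (\<integral>\<^sup>+\<omega>. H \<omega> \<partial>M)"
proof -
  note [measurable] = measurable_F_M[OF H]
  define w where "w = weight (window k) e"
  define g where "g = 8 + 2 * ln (real m / gap i j)"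
  have w: "w > 0"
    unfolding w_def by (rule weight_window_pos)
  have g: "g \<ge> 0"
    using gap_ge_1[of i j] gap_le_m[OF ij] by (simp add: g_def)
  have ww: "ennreal (1 / w * (1 / w)) = ennreal (1 / w) * ennreal (1 / w)"
    using w by (subst ennreal_mult) auto
  have kern: "(\<integral>\<^sup>+\<omega>. H \<omega> * indicator (ball y e) (S q \<omega>) \<partial>M) \<le> ennreal (kern i j (q - p)) * (\<integral>\<^sup>+\<omega>. H \<omega> \<partial>M)"
    if "{x, y} = {target k i, target k j}" "p \<le> q" "H \<in> borel_measurable (F p)" "\<And>\<omega>. H \<omega> \<noteq> 0 \<Longrightarrow> S p \<omega> \<in> ball x e" for x y p q H
  proof -
    have "x = target k i \<and> y = target k j \<or> x = target k j \<and> y = target k i"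
      using that(1) by (auto simp: doubleton_eq_iff)
    moreover have "kern j i = kern i j"
      by (simp add: kern_def gap_commute fun_eq_iff)
    ultimately show ?thesis
      using step_le_kern[OF that(2,3), of k i j] step_le_kern[OF that(2,3), of k j i] that(4) by auto
  qed
  have sum_le: "(\<Sum>q\<in>{q\<in>window k. p \<le> q}. kern i j (q - p)) \<le> w * g" if "p \<in> window k" for p
  proof -
    have "(\<Sum>q\<in>{q\<in>window k. p \<le> q}. kern i j (q - p)) = (\<Sum>u\<in>(\<lambda>q. q - p) ` {q\<in>window k. p \<le> q}. kern i j u)"
      by (subst sum.reindex) (auto simp: inj_on_def)
    also have "\<dots> \<le> (\<Sum>u\<le>(win_lo B k)\<^sup>2 * L. kern i j u)"
      by (intro sum_mono2) (auto simp: window_def kern_nonneg)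
    also have "\<dots> \<le> w * g"
      unfolding w_def g_def by (rule sum_kern_le[OF ij])
    finally show ?thesis .
  qed
  have "(\<integral>\<^sup>+\<omega>. H \<omega> * (visits k i \<omega> * visits k j \<omega>) \<partial>M)
      = ennreal (1 / w * (1 / w)) * (\<integral>\<^sup>+\<omega>. H \<omega> * (hits (window k) (target k i) e \<omega> * hits (window k) (target k j) e \<omega>) \<partial>M)"
    by (subst nn_integral_cmult[symmetric], measurable) (simp only: visits_def w_def[symmetric] ww mult_ac)
  also have "\<dots> \<le> ennreal (1 / w * (1 / w)) * (ennreal (2 * (real B / (real B - 1) * w * (w * g))) * (\<integral>\<^sup>+\<omega>. H \<omega> \<partial>M))"
  proof (rule mult_left_mono)
    show "(\<integral>\<^sup>+\<omega>. H \<omega> * (hits (window k) (target k i) e \<omega> * hits (window k) (target k j) e \<omega>) \<partial>M)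
        \<le> ennreal (2 * (real B / (real B - 1) * w * (w * g))) * (\<integral>\<^sup>+\<omega>. H \<omega> \<partial>M)"
      unfolding w_def
    proof (rule window_pair_le[where g = "kern i j", OF H])
      show "real B > 1"
        using B_ge by simp
      show "finite (window k)"
        by (simp add: window_def)
      show "0 \<le> weight (window k) e * g"
        using w g by (simp add: w_def)
    qed (use e_pos in \<open>simp_all add: window_start kern_nonneg kern sum_le[unfolded w_def]\<close>)
  qed simp
  also have "\<dots> = ennreal (2 * (real B / (real B - 1)) * g) * (\<integral>\<^sup>+\<omega>. H \<omega> \<partial>M)"
    unfolding mult.assoc[symmetric] using B_ge w g
    by (subst ennreal_mult[symmetric]) (auto simp: field_simps)
  also have "\<dots> \<le> ennreal (pair_bound i j) * (\<integral>\<^sup>+\<omega>. H \<omega> \<partial>M)"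
  proof (intro mult_right_mono ennreal_leI)
    have "real B / (real B - 1) \<le> 2"
      using B_ge by (simp add: field_simps)
    then have "2 * (real B / (real B - 1)) * g \<le> 2 * 2 * g"
      using g by (intro mult_right_mono mult_left_mono) auto
    then show "2 * (real B / (real B - 1)) * g \<le> pair_bound i j"
      by (simp add: pair_bound_def g_def)
  qed simp
  finally show ?thesis .
qed

end

section \<open>First and second moments\<close>

text \<open>Writing a block as a product over all windows, with \<open>1\<close> elsewhere, puts
  products of two blocks into the chronological form that \<open>prod_le\<close> needs.\<close>

lemma prod_blocks:
  fixes f :: "nat \<Rightarrow> 'c::comm_monoid_mult" and j N n :: nat
  assumes "j < N" "n > 0"
  shows "(\<Prod>k<N * n. if k div n = j then f k else 1) = (\<Prod>k\<in>{j * n..<j * n + n}. f k)"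
proof -
  have "{k \<in> {..<N * n}. k div n = j} = {j * n..<j * n + n}"
  proof (intro set_eqI iffI)
    fix k assume "k \<in> {j * n..<j * n + n}"
    then have "n * j \<le> k" "k < n * Suc j"
      by (auto simp: mult.commute)
    then have k: "k div n = j"
      by (rule div_nat_eqI)
    moreover have "k < N * n"
      using assms k by (simp add: less_mult_imp_div_less div_less_iff_less_mult[symmetric])
    ultimately show "k \<in> {k \<in> {..<N * n}. k div n = j}"
      by simp
  next
    fix k assume "k \<in> {k \<in> {..<N * n}. k div n = j}"
    then show "k \<in> {j * n..<j * n + n}"
      using assms div_times_less_eq_dividend[of k n] dividend_less_div_times[of n k] by auto
  qed
  then show ?thesis
    by (simp add: prod.If_cases Int_def)
qed

context arc_targets
begin

text \<open>The last window is peeled off, with the product over the earlier windows as weight.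
  Bounds that hold for every past weight thus multiply as if the windows were independent.\<close>

lemma prod_le:
  assumes V: "\<And>k. V k \<in> borel_measurable (F (start (Suc k)))"
    and le: "\<And>k H. H \<in> borel_measurable (F (start k)) \<Longrightarrow>
      (\<integral>\<^sup>+\<omega>. H \<omega> * V k \<omega> \<partial>M) \<le> ennreal (c k) * (\<integral>\<^sup>+\<omega>. H \<omega> \<partial>M)"
    and c: "\<And>k. c k \<ge> 0"
  shows "(\<lambda>\<omega>. \<Prod>k<K. V k \<omega>) \<in> borel_measurable (F (start K)) \<and>
    (\<integral>\<^sup>+\<omega>. (\<Prod>k<K. V k \<omega>) \<partial>M) \<le> ennreal (\<Prod>k<K. c k)"
proof (induction K)
  case 0
  then show ?case
    by (simp add: emeasure_space_1)
next
  case (Suc K)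
  then have meas: "(\<lambda>\<omega>. \<Prod>k<K. V k \<omega>) \<in> borel_measurable (F (start K))"
    and IH: "(\<integral>\<^sup>+\<omega>. (\<Prod>k<K. V k \<omega>) \<partial>M) \<le> ennreal (\<Prod>k<K. c k)"
    by auto
  have "(\<lambda>\<omega>. \<Prod>k<Suc K. V k \<omega>) \<in> borel_measurable (F (start (Suc K)))"
    using measurable_F_mono[OF meas start_le_Suc] V[of K] by simp
  moreover have "(\<integral>\<^sup>+\<omega>. (\<Prod>k<Suc K. V k \<omega>) \<partial>M) \<le> ennreal (\<Prod>k<Suc K. c k)"
  proof -
    have "(\<integral>\<^sup>+\<omega>. (\<Prod>k<K. V k \<omega>) * V K \<omega> \<partial>M) \<le> ennreal (c K) * (\<integral>\<^sup>+\<omega>. (\<Prod>k<K. V k \<omega>) \<partial>M)"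
      by (rule le[OF meas])
    also have "\<dots> \<le> ennreal (c K) * ennreal (\<Prod>k<K. c k)"
      by (intro mult_left_mono IH) simp
    also have "\<dots> = ennreal (\<Prod>k<Suc K. c k)"
      using c by (simp add: ennreal_mult[symmetric] prod_nonneg mult.commute)
    finally show ?thesis
      by simp
  qed
  ultimately show ?case ..
qed

section \<open>Second moments of blocks\<close>

definition block_visits :: "nat \<Rightarrow> nat \<Rightarrow> 'a \<Rightarrow> ennreal" where
  "block_visits j i \<omega> = (\<Prod>k\<in>{j * n..<j * n + n}. visits k i \<omega>)"

lemma block_visits_measurable [measurable]: "block_visits j i \<in> borel_measurable M"
  unfolding block_visits_def[abs_def] by measurable

lemma block_visits_eq:
  assumes "j < N"
  shows "block_visits j i \<omega> = (\<Prod>k<N * n. if k div n = j then visits k i \<omega> else 1)"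
  unfolding block_visits_def using assms n by (subst prod_blocks) auto

lemma pair_bound_nonneg: "i < m \<Longrightarrow> j < m \<Longrightarrow> pair_bound i j \<ge> 0"
  using gap_ge_1[of i j] gap_le_m[of i j] by (simp add: pair_bound_def)

text \<open>Different blocks share no window, so each factor is at most a single
  \<open>visits\<close> term and costs only \<open>B / (B - 1)\<close>, whether or not the
  directions agree.\<close>

lemma block_visits_pair_le_distinct:
  assumes "j < N" "j' < N" "j \<noteq> j'"
  shows "(\<integral>\<^sup>+\<omega>. block_visits j i \<omega> * block_visits j' i' \<omega> \<partial>M) \<le> ennreal ((real B / (real B - 1)) ^ (2 * n))"
proof -
  define V where "V k \<omega> = (if k div n = j then visits k i \<omega> else 1) * (if k div n = j' then visits k i' \<omega> else 1)" for k \<omega>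
  define b where "b = real B / (real B - 1)"
  define c where "c k = (if k div n = j then b else 1) * (if k div n = j' then b else 1)" for k
  have b: "b \<ge> 0"
    using B_ge by (simp add: b_def)
  have "(\<integral>\<^sup>+\<omega>. (\<Prod>k<N * n. V k \<omega>) \<partial>M) \<le> ennreal (\<Prod>k<N * n. c k)"
  proof (rule prod_le[THEN conjunct2])
    show "V k \<in> borel_measurable (F (start (Suc k)))" for k
      unfolding V_def[abs_def] using visits_measurable_F[of k] by measurable
    show "c k \<ge> 0" for k
      using b by (simp add: c_def)
    show "(\<integral>\<^sup>+\<omega>. H \<omega> * V k \<omega> \<partial>M) \<le> ennreal (c k) * (\<integral>\<^sup>+\<omega>. H \<omega> \<partial>M)"
      if "H \<in> borel_measurable (F (start k))" for k H
      using visits_le[OF that] assms by (auto simp: V_def c_def b_def)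
  qed
  moreover have "(\<Prod>k<N * n. c k) = b ^ (2 * n)"
    unfolding c_def prod.distrib using assms n by (simp add: prod_blocks power_mult power2_eq_square power_mult_distrib mult.commute[of 2])
  moreover have "(\<Prod>k<N * n. V k \<omega>) = block_visits j i \<omega> * block_visits j' i' \<omega>" for \<omega>
    unfolding V_def prod.distrib using assms by (simp add: block_visits_eq)
  ultimately show ?thesis
    by (simp add: b_def)
qed

lemma block_visits_pair_le_same:
  assumes "i < m" "i' < m"
  shows "(\<integral>\<^sup>+\<omega>. block_visits j i \<omega> * block_visits j i' \<omega> \<partial>M) \<le> ennreal (pair_bound i i' ^ n)"
proof -
  define V where "V k \<omega> = (if k div n = j then visits k i \<omega> else 1) * (if k div n = j then visits k i' \<omega> else 1)" for k \<omega>
  define c where "c k = (if k div n = j then pair_bound i i' else 1)" for k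
  have "(\<integral>\<^sup>+\<omega>. (\<Prod>k<Suc j * n. V k \<omega>) \<partial>M) \<le> ennreal (\<Prod>k<Suc j * n. c k)"
  proof (rule prod_le[THEN conjunct2])
    show "V k \<in> borel_measurable (F (start (Suc k)))" for k
      unfolding V_def[abs_def] using visits_measurable_F[of k] by measurable
    show "c k \<ge> 0" for k
      using pair_bound_nonneg assms by (simp add: c_def)
    show "(\<integral>\<^sup>+\<omega>. H \<omega> * V k \<omega> \<partial>M) \<le> ennreal (c k) * (\<integral>\<^sup>+\<omega>. H \<omega> \<partial>M)"
      if "H \<in> borel_measurable (F (start k))" for k H
      using visits_pair_le[OF that assms] by (auto simp: V_def c_def)
  qed
  moreover have "(\<Prod>k<Suc j * n. c k) = pair_bound i i' ^ n"
    unfolding c_def using n by (subst prod_blocks) auto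
  moreover have "(\<Prod>k<Suc j * n. V k \<omega>) = block_visits j i \<omega> * block_visits j i' \<omega>" for \<omega>
    unfolding V_def prod.distrib by (simp only: block_visits_eq[OF lessI])
  ultimately show ?thesis
    by simp
qed

text \<open>A power of a logarithm is dominated by a square root: with
  \<open>w = v powr (1 / (2 * real n))\<close> one has \<open>ln v = 2 n ln w \<le> 2 n w\<close>,
  so \<open>pair_bound\<close> is at most linear in \<open>w\<close>, and
  \<open>w ^ n = sqrt v\<close>.\<close>

lemma pair_bound_power_le:
  assumes "i < m" "i' < m"
  shows "pair_bound i i' ^ n \<le> (4 * (8 + 4 * real n)) ^ n * sqrt (real m / gap i i')"
proof -
  define v where "v = real m / gap i i'"
  define w where "w = v powr (1 / (2 * real n))"
  have v: "v \<ge> 1"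
    using gap_ge_1[of i i'] gap_le_m[OF assms] by (simp add: v_def)
  then have w: "w \<ge> 1"
    using n by (auto simp: w_def intro: ge_one_powr_ge_zero)
  have "ln v = 2 * real n * ln w"
    using v n by (simp add: w_def ln_powr)
  also have "\<dots> \<le> 2 * real n * w"
    using w by (intro mult_left_mono order.trans[OF ln_le_minus_one]) auto
  finally have "pair_bound i i' \<le> 4 * (8 * w + 4 * real n * w)"
    using w by (simp add: pair_bound_def v_def)
  then have "pair_bound i i' ^ n \<le> (4 * (8 + 4 * real n) * w) ^ n"
    using pair_bound_nonneg[OF assms] by (intro power_mono) (auto simp: algebra_simps)
  also have "w ^ n = sqrt v"
    using v w n by (simp add: w_def powr_realpow[symmetric] powr_powr powr_half_sqrt)
  then have "(4 * (8 + 4 * real n) * w) ^ n = (4 * (8 + 4 * real n)) ^ n * sqrt v"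
    by (simp add: power_mult_distrib)
  finally show ?thesis
    by (simp add: v_def)
qed

text \<open>Bounds the average over pairs of directions of the second moments within one block,
  uniformly in \<open>m\<close>, \<open>L\<close> and \<open>B\<close>; the \<open>5\<close> is that
  of \<open>sum_sqrt_gap_le\<close>.\<close>

definition moment_const :: real where
  "moment_const = 5 * (4 * (8 + 4 * real n)) ^ n"

lemma sum_pair_bound_le: "(\<Sum>i<m. \<Sum>i'<m. pair_bound i i' ^ n) \<le> moment_const * (real m)\<^sup>2"
proof -
  define C where "C = (4 * (8 + 4 * real n)) ^ n"
  have C: "C \<ge> 0"
    by (simp add: C_def)
  have "(\<Sum>i<m. \<Sum>i'<m. pair_bound i i' ^ n) \<le> (\<Sum>i<m. \<Sum>i'<m. C * sqrt (real m / gap i i'))"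
    unfolding C_def by (intro sum_mono pair_bound_power_le) auto
  also have "\<dots> = (\<Sum>i<m. C * (\<Sum>i'<m. sqrt (real m / gap i i')))"
    by (simp only: sum_distrib_left)
  also have "\<dots> \<le> (\<Sum>i<m. C * (5 * real m))"
    using C by (intro sum_mono mult_left_mono sum_sqrt_gap_le) auto
  also have "\<dots> = moment_const * (real m)\<^sup>2"
    by (simp add: moment_const_def C_def power2_eq_square)
  finally show ?thesis .
qed

section \<open>Lower bound for the mean of a block\<close>

definition radius :: real where
  "radius = (real n + 1) * r"

lemma ball_target_subset: "i < m \<Longrightarrow> ball (target k i) e \<subseteq> cball 0 radius"
proof
  fix y assume "i < m" and y: "y \<in> ball (target k i) e"
  have "norm (arc_dir (real i / real m)) = 1"
    using \<open>i < m\<close> by (intro norm_arc_dir) auto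
  then have "norm (target k i) = (real (k mod n) + 1) * r"
    using r by (simp add: target_def)
  also have "\<dots> \<le> real n * r"
  proof (rule mult_right_mono)
    have "k mod n + 1 \<le> n"
      using mod_less_divisor[of n k] n by linarith
    then show "real (k mod n) + 1 \<le> real n"
      by linarith
  qed (use r in simp)
  finally have "norm (target k i) \<le> real n * r" .
  moreover have "dist (target k i) y < e"
    using y by simp
  moreover have "e \<le> r"
    using r m by (simp add: e_eq field_simps)
  moreover have "norm y \<le> norm (target k i) + dist (target k i) y"
    by (metis dist_commute dist_norm norm_triangle_sub)
  ultimately show "y \<in> cball 0 radius"
    by (simp add: radius_def algebra_simps)
qed

text \<open>The loss in \<open>step_ge_disc\<close> when the lag is at least \<open>B - 1\<close> in
  time and both ends are within \<open>radius\<close>; it tends to \<open>1\<close> as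
  \<open>B\<close> grows.\<close>

definition lower_const :: real where
  "lower_const = exp (- 2 * radius\<^sup>2 / (real B - 1))"

text \<open>The Gaussian factor costs \<open>lower_const\<close>, and the remaining
  \<open>1 / (q - p)\<close> is at least \<open>1 / q\<close>, so summing over the window restores
  \<open>weight\<close>.\<close>

lemma visits_step_ge:
  assumes H: "H \<in> borel_measurable (F p)" and i: "i < m"
    and supp: "\<And>\<omega>. H \<omega> \<noteq> 0 \<Longrightarrow> norm (S p \<omega>) \<le> radius"
    and gap: "\<And>q. q \<in> window k \<Longrightarrow> p < q \<and> real B - 1 \<le> real (q - p) * h"
  shows "ennreal lower_const * (\<integral>\<^sup>+\<omega>. H \<omega> \<partial>M) \<le> (\<integral>\<^sup>+\<omega>. H \<omega> * visits k i \<omega> \<partial>M)"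
proof -
  note [measurable] = measurable_F_M[OF H]
  define w where "w = weight (window k) e"
  have w: "w > 0"
    unfolding w_def by (rule weight_window_pos)
  have step: "ennreal (lower_const * (e\<^sup>2 / (2 * (real q * h)))) * (\<integral>\<^sup>+\<omega>. H \<omega> \<partial>M)
      \<le> (\<integral>\<^sup>+\<omega>. H \<omega> * indicator (ball (target k i) e) (S q \<omega>) \<partial>M)" if "q \<in> window k" for q
  proof (rule order_trans[OF mult_right_mono])
    have q: "p < q" "real B - 1 \<le> real (q - p) * h"
      using gap[OF that] by auto
    show "ennreal (exp (- 2 * radius\<^sup>2 / (real (q - p) * h)) * (e\<^sup>2 / (2 * (real (q - p) * h)))) * (\<integral>\<^sup>+\<omega>. H \<omega> \<partial>M)
      \<le> (\<integral>\<^sup>+\<omega>. H \<omega> * indicator (ball (target k i) e) (S q \<omega>) \<partial>M)"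
      using e_pos by (intro step_ge_disc supp ball_target_subset i q H) auto
    show "ennreal (lower_const * (e\<^sup>2 / (2 * (real q * h))))
      \<le> ennreal (exp (- 2 * radius\<^sup>2 / (real (q - p) * h)) * (e\<^sup>2 / (2 * (real (q - p) * h))))"
      unfolding lower_const_def
    proof (intro ennreal_leI mult_mono)
      have "2 * radius\<^sup>2 / (real (q - p) * h) \<le> 2 * radius\<^sup>2 / (real B - 1)"
        using q B_ge h_pos by (intro divide_left_mono mult_pos_pos) auto
      then show "exp (- 2 * radius\<^sup>2 / (real B - 1)) \<le> exp (- 2 * radius\<^sup>2 / (real (q - p) * h))"
        by simp
      show "e\<^sup>2 / (2 * (real q * h)) \<le> e\<^sup>2 / (2 * (real (q - p) * h))"
        using q h_pos by (intro divide_left_mono mult_left_mono mult_right_mono mult_pos_pos) auto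
    qed (use h_pos in auto)
  qed auto
  have "ennreal (lower_const * w) * (\<integral>\<^sup>+\<omega>. H \<omega> \<partial>M)
      = (\<Sum>q\<in>window k. ennreal (lower_const * (e\<^sup>2 / (2 * (real q * h)))) * (\<integral>\<^sup>+\<omega>. H \<omega> \<partial>M))"
    unfolding w_def weight_def sum_distrib_left sum_distrib_right[symmetric]
    using h_pos by (subst sum_ennreal) (auto simp: lower_const_def)
  also have "\<dots> \<le> (\<Sum>q\<in>window k. \<integral>\<^sup>+\<omega>. H \<omega> * indicator (ball (target k i) e) (S q \<omega>) \<partial>M)"
    by (intro sum_mono step)
  also have "\<dots> = (\<integral>\<^sup>+\<omega>. H \<omega> * hits (window k) (target k i) e \<omega> \<partial>M)"
    unfolding hits_def sum_distrib_left by (intro nn_integral_sum[symmetric]) measurable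
  finally have "ennreal (1 / w) * (ennreal (lower_const * w) * (\<integral>\<^sup>+\<omega>. H \<omega> \<partial>M))
      \<le> ennreal (1 / w) * (\<integral>\<^sup>+\<omega>. H \<omega> * hits (window k) (target k i) e \<omega> \<partial>M)"
    by (intro mult_left_mono) auto
  also have "\<dots> = (\<integral>\<^sup>+\<omega>. H \<omega> * visits k i \<omega> \<partial>M)"
    unfolding visits_def w_def by (subst nn_integral_cmult[symmetric]) (auto simp: mult_ac)
  also have "ennreal (1 / w) * (ennreal (lower_const * w) * (\<integral>\<^sup>+\<omega>. H \<omega> \<partial>M)) = ennreal lower_const * (\<integral>\<^sup>+\<omega>. H \<omega> \<partial>M)"
    unfolding w_def mult.assoc[symmetric] by (subst ennreal_weight_cancel) (auto simp: lower_const_def)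
  finally show ?thesis .
qed

lemma window_Suc_gap:
  assumes "p \<in> window k" "q \<in> window (Suc k)"
  shows "p < q \<and> real B - 1 \<le> real (q - p) * h"
proof -
  define a where "a = win_lo B k"
  have a: "real a \<ge> 3"
    unfolding a_def by (rule win_lo_ge_3)
  have "real p \<le> (real a)\<^sup>2 * real L" "real B * (real a)\<^sup>2 * real L \<le> real q"
    using assms unfolding window_def a_def atLeastAtMost_iff win_lo.simps
    by (simp_all only: of_nat_mult[symmetric] of_nat_power[symmetric] of_nat_le_iff)
  then have "((real B - 1) * (real a)\<^sup>2) * real L \<le> real q - real p"
    by (simp add: algebra_simps)
  moreover have "(real B - 1) * 1 \<le> (real B - 1) * (real a)\<^sup>2"
    using a B_ge by (intro mult_left_mono one_le_power) auto
  then have "(real B - 1) * real L \<le> ((real B - 1) * (real a)\<^sup>2) * real L"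
    by (intro mult_right_mono) auto
  ultimately have *: "(real B - 1) * real L \<le> real q - real p"
    by linarith
  moreover have "0 < (real B - 1) * real L"
    using B_ge L by simp
  ultimately have "p < q"
    by linarith
  with * show ?thesis
    using L by (simp add: h_eq of_nat_diff field_simps)
qed

lemma window_0_gap:
  assumes "q \<in> window k"
  shows "0 < q \<and> real B - 1 \<le> real (q - 0) * h"
proof -
  have "real (win_lo B k) * real L \<le> real q"
    using assms unfolding window_def atLeastAtMost_iff by (simp only: of_nat_mult[symmetric] of_nat_le_iff)
  moreover have "real B * real L \<le> real (win_lo B k) * real L"
    by (intro mult_right_mono win_lo_ge_B) auto
  ultimately have "real B * real L \<le> real q"
    by linarith
  moreover have "0 < real B * real L"
    using B_ge L by simp
  ultimately have "q > 0" "real B \<le> real q * h"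
    using L by (auto simp: h_eq field_simps)
  then show ?thesis
    by simp
qed

lemma start_mono: "k \<le> l \<Longrightarrow> start k \<le> start l"
  by (rule lift_Suc_mono_le[of start]) (auto intro: start_le_Suc)

lemma prod_visits_measurable_F: "(\<lambda>\<omega>. \<Prod>k\<in>{k0..<k1}. visits k i \<omega>) \<in> borel_measurable (F (start k1))"
proof (rule borel_measurable_prod_ennreal)
  fix k assume "k \<in> {k0..<k1}"
  then show "visits k i \<in> borel_measurable (F (start k1))"
    by (intro measurable_F_mono[OF visits_measurable_F] start_mono) auto
qed

text \<open>Windows are appended one at a time. \<open>visits_step_ge\<close> needs the position of
  the walk at a known time, so the last completed window is resolved into the times of its visits,
  at which the walk sits in a target disc; for the first window the starting point \<open>0\<close>
  serves instead.\<close>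

lemma prod_visits_ge:
  assumes i: "i < m"
  shows "ennreal (lower_const ^ l) \<le> (\<integral>\<^sup>+\<omega>. (\<Prod>k\<in>{k0..<k0 + l}. visits k i \<omega>) \<partial>M)"
proof (induction l)
  case 0
  then show ?case
    by (simp add: emeasure_space_1)
next
  case (Suc l)
  have "ennreal lower_const * (\<integral>\<^sup>+\<omega>. (\<Prod>k\<in>{k0..<k0 + l}. visits k i \<omega>) \<partial>M)
      \<le> (\<integral>\<^sup>+\<omega>. (\<Prod>k\<in>{k0..<k0 + l}. visits k i \<omega>) * visits (k0 + l) i \<omega> \<partial>M)"
  proof (cases l)
    case 0
    have "0 \<le> radius"
      using r by (simp add: radius_def)
    then show ?thesis
      using visits_step_ge[of "\<lambda>_. 1" 0 i "k0"] window_0_gap i 0 by (simp add: S_0)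
  next
    case (Suc l')
    define k where "k = k0 + l'"
    define T where "T = (\<lambda>\<omega>. \<Prod>k\<in>{k0..<k}. visits k i \<omega>)"
    define w where "w = weight (window k) e"
    \<comment> \<open>The part of the product due to a visit of window \<open>k\<close> at time
      \<open>p\<close>; it is known at time \<open>p\<close> and vanishes unless the walk is within
      \<open>radius\<close> then.\<close>
    define Hp where "Hp p \<omega> = T \<omega> * (ennreal (1 / w) * indicator (ball (target k i) e) (S p \<omega>))" for p \<omega>
    have [measurable]: "T \<in> borel_measurable M"
      unfolding T_def by measurable
    have [measurable]: "Hp p \<in> borel_measurable M" for p
      unfolding Hp_def[abs_def] by measurable
    have split: "(\<Prod>k\<in>{k0..<k0 + l}. visits k i \<omega>) = (\<Sum>p\<in>window k. Hp p \<omega>)" for \<omega>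
      using Suc by (simp add: T_def k_def Hp_def visits_def w_def hits_def sum_distrib_left)
    have le: "ennreal lower_const * (\<integral>\<^sup>+\<omega>. Hp p \<omega> \<partial>M) \<le> (\<integral>\<^sup>+\<omega>. Hp p \<omega> * visits (Suc k) i \<omega> \<partial>M)"
      if p: "p \<in> window k" for p
    proof (rule visits_step_ge[OF _ i])
      have "start k \<le> p"
      proof -
        have "1 * real (start k) \<le> real B * real (start k)"
          using B_ge by (intro mult_right_mono) auto
        then show ?thesis
          using window_start[OF p] by linarith
      qed
      then have "T \<in> borel_measurable (F p)"
        unfolding T_def by (intro measurable_F_mono[OF prod_visits_measurable_F])
      then show "Hp p \<in> borel_measurable (F p)"
        unfolding Hp_def[abs_def] using S_adapted[of p] by measurable
      show "norm (S p \<omega>) \<le> radius" if "Hp p \<omega> \<noteq> 0" for \<omega>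
        using that ball_target_subset[OF i, of k] by (auto simp: Hp_def indicator_def split: if_splits)
      show "p < q \<and> real B - 1 \<le> real (q - p) * h" if "q \<in> window (Suc k)" for q
        using window_Suc_gap[OF p that] .
    qed
    have "ennreal lower_const * (\<integral>\<^sup>+\<omega>. (\<Sum>p\<in>window k. Hp p \<omega>) \<partial>M)
        = (\<Sum>p\<in>window k. ennreal lower_const * (\<integral>\<^sup>+\<omega>. Hp p \<omega> \<partial>M))"
      by (simp add: nn_integral_sum sum_distrib_left)
    also have "\<dots> \<le> (\<Sum>p\<in>window k. \<integral>\<^sup>+\<omega>. Hp p \<omega> * visits (Suc k) i \<omega> \<partial>M)"
      by (intro sum_mono le)
    also have "\<dots> = (\<integral>\<^sup>+\<omega>. (\<Sum>p\<in>window k. Hp p \<omega>) * visits (Suc k) i \<omega> \<partial>M)"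
      by (simp add: nn_integral_sum sum_distrib_right)
    finally show ?thesis
      unfolding split using Suc by (simp add: k_def)
  qed
  moreover have "ennreal (lower_const ^ Suc l) \<le> ennreal lower_const * (\<integral>\<^sup>+\<omega>. (\<Prod>k\<in>{k0..<k0 + l}. visits k i \<omega>) \<partial>M)"
    using mult_left_mono[OF Suc.IH, of "ennreal lower_const"] by (simp add: ennreal_mult lower_const_def)
  ultimately show ?case
    by (auto intro: order_trans)
qed

section \<open>The second-moment method\<close>

definition total_visits :: "nat \<Rightarrow> 'a \<Rightarrow> ennreal" where
  "total_visits N \<omega> = (\<Sum>j<N. \<Sum>i<m. block_visits j i \<omega>)"

lemma total_visits_measurable [measurable]: "total_visits N \<in> borel_measurable M"
  unfolding total_visits_def[abs_def] by measurable

lemma first_moment: "ennreal (real N * (real m * lower_const ^ n)) \<le> (\<integral>\<^sup>+\<omega>. total_visits N \<omega> \<partial>M)"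
proof -
  have "ennreal (real N * (real m * lower_const ^ n)) = (\<Sum>j<N. \<Sum>i<m. ennreal (lower_const ^ n))"
    by (simp add: ennreal_mult ennreal_of_nat_eq_real_of_nat lower_const_def)
  also have "\<dots> \<le> (\<Sum>j<N. \<Sum>i<m. \<integral>\<^sup>+\<omega>. block_visits j i \<omega> \<partial>M)"
    unfolding block_visits_def by (intro sum_mono prod_visits_ge) auto
  also have "\<dots> = (\<integral>\<^sup>+\<omega>. total_visits N \<omega> \<partial>M)"
    unfolding total_visits_def by (simp add: nn_integral_sum)
  finally show ?thesis .
qed

lemma second_moment:
  "(\<integral>\<^sup>+\<omega>. (total_visits N \<omega>)\<^sup>2 \<partial>M)
    \<le> ennreal (real N * moment_const * (real m)\<^sup>2 + (real N)\<^sup>2 * (real m)\<^sup>2 * (real B / (real B - 1)) ^ (2 * n))"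
proof -
  define b where "b = (real B / (real B - 1)) ^ (2 * n)"
  have b: "b \<ge> 0"
    using B_ge by (simp add: b_def)
  define s where "s j j' = (\<Sum>i<m. \<Sum>i'<m. (if j = j' then pair_bound i i' ^ n else b))" for j j' :: nat
  have nonneg: "0 \<le> (if j = j' then pair_bound i i' ^ n else b)" if "i < m" "i' < m" for i i' and j j' :: nat
    using b pair_bound_nonneg[OF that] by simp
  have s_nonneg: "s j j' \<ge> 0" for j j'
    unfolding s_def by (intro sum_nonneg nonneg) auto
  have s_ennreal: "(\<Sum>i<m. \<Sum>i'<m. ennreal (if j = j' then pair_bound i i' ^ n else b)) = ennreal (s j j')" for j j'
  proof -
    have "(\<Sum>i<m. \<Sum>i'<m. ennreal (if j = j' then pair_bound i i' ^ n else b))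
        = (\<Sum>i<m. ennreal (\<Sum>i'<m. if j = j' then pair_bound i i' ^ n else b))"
      by (intro sum.cong refl sum_ennreal nonneg) auto
    also have "\<dots> = ennreal (s j j')"
      unfolding s_def by (intro sum_ennreal sum_nonneg nonneg) auto
    finally show ?thesis .
  qed
  have "(\<integral>\<^sup>+\<omega>. (total_visits N \<omega>)\<^sup>2 \<partial>M)
      = (\<Sum>j<N. \<Sum>j'<N. \<Sum>i<m. \<Sum>i'<m. \<integral>\<^sup>+\<omega>. block_visits j i \<omega> * block_visits j' i' \<omega> \<partial>M)"
    unfolding total_visits_def power2_eq_square sum_product by (simp add: nn_integral_sum)
  also have "\<dots> \<le> (\<Sum>j<N. \<Sum>j'<N. \<Sum>i<m. \<Sum>i'<m. ennreal (if j = j' then pair_bound i i' ^ n else b))"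
    using block_visits_pair_le_distinct block_visits_pair_le_same
    by (intro sum_mono) (auto simp: b_def)
  also have "\<dots> = ennreal (\<Sum>j<N. \<Sum>j'<N. s j j')"
    by (simp add: s_ennreal sum_ennreal s_nonneg sum_nonneg)
  also have "\<dots> \<le> ennreal (real N * moment_const * (real m)\<^sup>2 + (real N)\<^sup>2 * (real m)\<^sup>2 * b)"
  proof (rule ennreal_leI)
    \<comment> \<open>The bound \<open>m^2 b\<close> for distinct blocks is added on the diagonal
      too, which makes the count of its pairs exactly \<open>N^2\<close>.\<close>
    have "(\<Sum>j<N. \<Sum>j'<N. s j j') \<le> (\<Sum>j<N. \<Sum>j'<N. (if j = j' then moment_const * (real m)\<^sup>2 else 0) + (real m)\<^sup>2 * b)"
      using sum_pair_bound_le b by (intro sum_mono) (auto simp: s_def power2_eq_square intro: add_increasing2)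
    also have "\<dots> = real N * moment_const * (real m)\<^sup>2 + (real N)\<^sup>2 * (real m)\<^sup>2 * b"
      by (simp add: sum.distrib power2_eq_square algebra_simps)
    finally show "(\<Sum>j<N. \<Sum>j'<N. s j j') \<le> real N * moment_const * (real m)\<^sup>2 + (real N)\<^sup>2 * (real m)\<^sup>2 * b" .
  qed
  finally show ?thesis
    by (simp add: b_def)
qed

text \<open>Cauchy-Schwarz for \<open>X = X * indicator G\<close> gives
  \<open>(E X)^2 \<le> E (X^2) * P G\<close>. The common factor \<open>(N m)^2\<close> cancels, so
  \<open>m\<close> disappears from the bound.\<close>

lemma prob_total_pos:
  assumes N: "N > 0"
  shows "lower_const ^ (2 * n) / (moment_const / real N + (real B / (real B - 1)) ^ (2 * n))
    \<le> prob {\<omega> \<in> space M. total_visits N \<omega> \<noteq> 0}"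
proof -
  define G where "G = {\<omega> \<in> space M. total_visits N \<omega> \<noteq> 0}"
  have G [measurable]: "G \<in> sets M"
    unfolding G_def by measurable
  define b where "b = (real B / (real B - 1)) ^ (2 * n)"
  define a where "a = real N * (real m * lower_const ^ n)"
  define c where "c = real N * moment_const * (real m)\<^sup>2 + (real N)\<^sup>2 * (real m)\<^sup>2 * b"
  have b: "b > 0"
    using B_ge by (simp add: b_def)
  have K: "moment_const > 0"
    by (simp add: moment_const_def add_pos_nonneg)
  have "c \<ge> 0"
    using b K by (simp add: c_def)
  have "(ennreal a)\<^sup>2 \<le> (\<integral>\<^sup>+\<omega>. total_visits N \<omega> * indicator G \<omega> \<partial>M)\<^sup>2"
  proof -
    have "(\<integral>\<^sup>+\<omega>. total_visits N \<omega> \<partial>M) = (\<integral>\<^sup>+\<omega>. total_visits N \<omega> * indicator G \<omega> \<partial>M)"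
      by (intro nn_integral_cong) (auto simp: G_def indicator_def)
    then show ?thesis
      using first_moment[of N] by (intro power_mono) (auto simp: a_def)
  qed
  also have "\<dots> \<le> (\<integral>\<^sup>+\<omega>. (total_visits N \<omega>)\<^sup>2 \<partial>M) * (\<integral>\<^sup>+\<omega>. (indicator G \<omega>)\<^sup>2 \<partial>M)"
    by (rule Cauchy_Schwarz_nn_integral) measurable
  also have "(\<integral>\<^sup>+\<omega>. (indicator G \<omega>)\<^sup>2 \<partial>M) = ennreal (prob G)"
  proof -
    have "(\<integral>\<^sup>+\<omega>. (indicator G \<omega>)\<^sup>2 \<partial>M) = (\<integral>\<^sup>+\<omega>. indicator G \<omega> \<partial>M)"
      by (intro nn_integral_cong) (auto simp: indicator_def)
    then show ?thesis
      by (simp add: emeasure_eq_measure)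
  qed
  also have "(\<integral>\<^sup>+\<omega>. (total_visits N \<omega>)\<^sup>2 \<partial>M) \<le> ennreal c"
    unfolding c_def b_def by (rule second_moment)
  finally have "(ennreal a)\<^sup>2 \<le> ennreal (c * prob G)"
    using \<open>c \<ge> 0\<close> by (simp add: ennreal_mult mult_right_mono)
  moreover have "a \<ge> 0"
    by (simp add: a_def lower_const_def)
  ultimately have "a\<^sup>2 \<le> c * prob G"
    using \<open>c \<ge> 0\<close> by (simp add: ennreal_power)
  moreover have "a\<^sup>2 = (real N * real m)\<^sup>2 * lower_const ^ (2 * n)"
    by (simp add: a_def power_mult_distrib power_mult[symmetric] mult.commute)
  moreover have "c = (real N * real m)\<^sup>2 * (moment_const / real N + b)"
    using N by (simp add: c_def field_simps power2_eq_square)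
  moreover have "(real N * real m)\<^sup>2 > 0"
    using N m by simp
  ultimately have "lower_const ^ (2 * n) \<le> (moment_const / real N + b) * prob G"
    by (simp add: mult.assoc)
  moreover have "moment_const / real N + b > 0"
    using K b N by (simp add: add_pos_pos)
  ultimately show ?thesis
    unfolding G_def[symmetric] b_def[symmetric] by (simp add: divide_le_eq mult.commute)
qed

lemma total_visits_nonzero_imp_hits:
  assumes "total_visits N \<omega> \<noteq> 0"
  shows "\<exists>i<m. \<forall>k\<in>{1..n}. \<exists>p\<le>(win_lo B (N * n))\<^sup>2 * L.
    dist (S p \<omega>) ((real k * r) *\<^sub>R arc_dir (real i / real m)) < e"
proof -
  obtain j i where ji: "j < N" "i < m" "block_visits j i \<omega> \<noteq> 0"
    using assms by (auto simp: total_visits_def sum_eq_0_iff)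
  have "\<exists>p\<le>(win_lo B (N * n))\<^sup>2 * L. dist (S p \<omega>) ((real k * r) *\<^sub>R arc_dir (real i / real m)) < e"
    if k: "k \<in> {1..n}" for k
  proof -
    \<comment> \<open>The window of block \<open>j\<close> that aims at point number
      \<open>k\<close>: positions within a block count from \<open>0\<close>, points from
      \<open>1\<close>.\<close>
    define k' where "k' = j * n + (k - 1)"
    have k': "k' \<in> {j * n..<j * n + n}" "k' mod n = k - 1"
      using k by (auto simp: k'_def simp del: add_diff_assoc)
    have "visits k' i \<omega> \<noteq> 0"
      using ji(3) k'(1) by (auto simp: block_visits_def)
    then have "hits (window k') (target k' i) e \<omega> \<noteq> 0"
      by (auto simp: visits_def)
    then obtain p where "p \<in> window k'" "indicator (ball (target k' i) e) (S p \<omega>) \<noteq> (0 :: ennreal)"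
      unfolding hits_def by (rule sum.not_neutral_contains_not_neutral)
    then have p: "p \<in> window k'" "S p \<omega> \<in> ball (target k' i) e"
      by (auto simp: indicator_def split: if_splits)
    have "k' \<le> N * n"
    proof -
      have "Suc j * n \<le> N * n"
        using ji by (intro mult_right_mono) auto
      then show ?thesis
        using k'(1) by simp
    qed
    then have "(win_lo B k')\<^sup>2 * L \<le> (win_lo B (N * n))\<^sup>2 * L"
      using B_ge by (intro mult_right_mono power_mono win_lo_mono) auto
    then have "p \<le> (win_lo B (N * n))\<^sup>2 * L"
      using p(1) unfolding window_def atLeastAtMost_iff by linarith
    moreover have "real (k' mod n) + 1 = real k"
      using k k'(2) by simp
    ultimately show ?thesis
      using p(2) by (auto simp: target_def dist_commute)
  qed
  with ji show ?thesis
    by blast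
qed

end

section \<open>Passage to the limit\<close>

text \<open>The bound of \<open>prob_total_pos\<close> with \<open>N = B\<close>, written out as a
  function of \<open>n\<close>, \<open>r\<close> and \<open>B\<close> alone. Tying the number of
  blocks to the ratio \<open>B\<close> leaves a single limit to take.\<close>

definition success_bound :: "nat \<Rightarrow> real \<Rightarrow> nat \<Rightarrow> real" where
  "success_bound n r B = exp (- 2 * ((real n + 1) * r)\<^sup>2 / (real B - 1)) ^ (2 * n)
    / (5 * (4 * (8 + 4 * real n)) ^ n / real B + (real B / (real B - 1)) ^ (2 * n))"

lemma success_bound_tendsto: "success_bound n r \<longlonglongrightarrow> 1"
proof -
  have lim: "filterlim (\<lambda>B. real B - 1) at_top sequentially"
    using filterlim_tendsto_add_at_top[OF tendsto_const[of "-1"] filterlim_real_sequentially] by simp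
  have lim0: "(\<lambda>B. c / (real B - 1)) \<longlonglongrightarrow> 0" for c
    by (rule real_tendsto_divide_at_top[OF tendsto_const lim])
  have "(\<lambda>B. exp (- 2 * ((real n + 1) * r)\<^sup>2 / (real B - 1))) \<longlonglongrightarrow> exp 0"
    by (intro tendsto_exp lim0)
  moreover have "(\<lambda>B. 5 * (4 * (8 + 4 * real n)) ^ n / real B) \<longlonglongrightarrow> 0"
    by (rule real_tendsto_divide_at_top[OF tendsto_const filterlim_real_sequentially])
  moreover have "(\<lambda>B. real B / (real B - 1)) \<longlonglongrightarrow> 1"
  proof (rule Lim_transform_eventually)
    show "(\<lambda>B. 1 + 1 / (real B - 1)) \<longlonglongrightarrow> 1"
      using tendsto_add[OF tendsto_const lim0] by fastforce
    \<comment> \<open>At \<open>B = 1\<close> division by zero makes the two sides \<open>1\<close>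
      and \<open>0\<close>, so the identity holds only eventually.\<close>
    show "\<forall>\<^sub>F B in sequentially. 1 + 1 / (real B - 1) = real B / (real B - 1)"
      using eventually_ge_at_top[of 2] by eventually_elim (simp add: field_simps)
  qed
  ultimately have "success_bound n r \<longlonglongrightarrow> (exp 0) ^ (2 * n) / (0 + 1 ^ (2 * n))"
    unfolding success_bound_def[abs_def]
    by (intro tendsto_divide tendsto_power tendsto_add) auto
  then show ?thesis
    by simp
qed

text \<open>The time horizon depends on \<open>B\<close> and \<open>n\<close> but not on
  \<open>m\<close>, since grid indices up to \<open>a^2 L\<close> are times up to
  \<open>a^2\<close>; the compactness argument rests on this.\<close>

lemma approximate_progression:
  fixes W :: "real \<Rightarrow> 'a \<Rightarrow> real ^ 2"
  assumes "standard_brownian_motion M W" and "n \<ge> 1" "m \<ge> 1" "r > 0"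
    and B: "real B \<ge> 3" "real B \<ge> 16 / r\<^sup>2"
  shows "\<exists>G\<in>sets M. success_bound n r B \<le> measure M G \<and>
    (\<forall>\<omega>\<in>G. \<exists>s\<in>{0..1}. \<forall>k\<in>{1..n}. \<exists>t\<in>{0..real ((win_lo B (B * n))\<^sup>2)}.
      dist (W t \<omega> - W 0 \<omega>) ((real k * r) *\<^sub>R arc_dir s) < r / (4 * real m))"
proof -
  define e where "e = r / (4 * real m)"
  \<comment> \<open>Grid points per unit time, numerous enough for \<open>h \<le> e^2\<close>;
    \<open>Suc\<close> makes \<open>L\<close> visibly positive.\<close>
  define L where "L = Suc (nat \<lceil>1 / e\<^sup>2\<rceil>)"
  define h where "h = 1 / real L"
  have e: "e > 0"
    using assms by (simp add: e_def)
  have L_pos: "real L > 0"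
    unfolding L_def by (simp only: of_nat_0_less_iff zero_less_Suc)
  then have h: "h > 0"
    by (simp add: h_def)
  have "1 / e\<^sup>2 \<le> real L"
    using real_nat_ceiling_ge[of "1 / e\<^sup>2"] unfolding L_def by linarith
  then have h_le: "h \<le> e\<^sup>2"
    using e L_pos by (simp add: h_def field_simps)
  obtain F where "planar_gaussian_walk M F (\<lambda>p \<omega>. W (real p * h) \<omega> - W 0 \<omega>) h"
    using standard_brownian_motion_imp_walk[OF assms(1) h] by blast
  then interpret planar_gaussian_walk M F "\<lambda>p \<omega>. W (real p * h) \<omega> - W 0 \<omega>" h .
  interpret arc_targets M F "\<lambda>p \<omega>. W (real p * h) \<omega> - W 0 \<omega>" h n m L B r e
    by unfold_locales (use assms h_le in \<open>auto simp: L_def h_def e_def\<close>)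
  define G where "G = {\<omega> \<in> space M. total_visits B \<omega> \<noteq> 0}"
  have "G \<in> sets M"
    unfolding G_def by measurable
  moreover have "success_bound n r B \<le> prob G"
    using prob_total_pos[of B] B
    by (simp add: G_def success_bound_def lower_const_def moment_const_def radius_def)
  moreover have "\<exists>s\<in>{0..1}. \<forall>k\<in>{1..n}. \<exists>t\<in>{0..real ((win_lo B (B * n))\<^sup>2)}.
      dist (W t \<omega> - W 0 \<omega>) ((real k * r) *\<^sub>R arc_dir s) < r / (4 * real m)" if "\<omega> \<in> G" for \<omega>
  proof -
    have "total_visits B \<omega> \<noteq> 0"
      using that by (simp add: G_def)
    then obtain i where i: "i < m" and hit: "\<And>k. k \<in> {1..n} \<Longrightarrow> \<exists>p\<le>(win_lo B (B * n))\<^sup>2 * L.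
        dist (W (real p * h) \<omega> - W 0 \<omega>) ((real k * r) *\<^sub>R arc_dir (real i / real m)) < e"
      using total_visits_nonzero_imp_hits[of B \<omega>] by blast
    show ?thesis
    proof (rule bexI[of _ "real i / real m"], rule ballI)
      show "real i / real m \<in> {0..1}"
        using i by simp
      fix k assume "k \<in> {1..n}"
      from hit[OF this] obtain p where p: "p \<le> (win_lo B (B * n))\<^sup>2 * L"
          "dist (W (real p * h) \<omega> - W 0 \<omega>) ((real k * r) *\<^sub>R arc_dir (real i / real m)) < e"
        by blast
      have "real p \<le> real ((win_lo B (B * n))\<^sup>2 * L)"
        using p(1) by (simp only: of_nat_le_iff)
      then have "real p * h \<le> real ((win_lo B (B * n))\<^sup>2)"
        using L by (simp add: h_def field_simps)
      then show "\<exists>t\<in>{0..real ((win_lo B (B * n))\<^sup>2)}.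
          dist (W t \<omega> - W 0 \<omega>) ((real k * r) *\<^sub>R arc_dir (real i / real m)) < r / (4 * real m)"
        using p(2) h by (intro bexI[of _ "real p * h"]) (auto simp: e_def)
    qed
  qed
  ultimately show ?thesis
    by blast
qed

section \<open>Compactness of the path\<close>

lemma continuous_on_arc_dir: "continuous_on A arc_dir"
proof -
  have "arc_dir = (\<lambda>s. s *\<^sub>R axis 1 1 + sqrt (1 - s\<^sup>2) *\<^sub>R axis 2 1)"
    by (simp add: fun_eq_iff vec_eq_iff forall_2 arc_dir_def axis_def)
  then show ?thesis
    by (rule ssubst) (intro continuous_intros)
qed

text \<open>The parameters \<open>s j\<close> have a convergent subsequence, the same for all
  \<open>k\<close>. Along it the distances to \<open>K\<close> tend to \<open>0\<close> and, by
  continuity of \<open>infdist\<close>, to the distance at the limit direction; a closed set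
  contains its points at distance \<open>0\<close>.\<close>

lemma compact_hits_all:
  fixes K :: "(real ^ 2) set"
  assumes K: "compact K"
    and approx: "\<And>j. \<exists>s\<in>{0..1}. \<forall>k\<in>{1..n}. \<exists>y\<in>K. dist y ((real k * r) *\<^sub>R arc_dir s) < r / real (Suc j)"
  shows "\<exists>s\<in>{0..1}. \<forall>k\<in>{1..n}. (real k * r) *\<^sub>R arc_dir s \<in> K"
proof -
  obtain s where s: "\<And>j. s j \<in> {0..1 :: real}"
    and near: "\<And>j k. k \<in> {1..n} \<Longrightarrow> \<exists>y\<in>K. dist y ((real k * r) *\<^sub>R arc_dir (s j)) < r / real (Suc j)"
    using approx by metis
  obtain l \<phi> where l: "l \<in> {0..1}" and \<phi>: "strict_mono \<phi>" and lim: "(s \<circ> \<phi>) \<longlonglongrightarrow> l"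
    using compact_Icc[of "0 :: real" 1] s unfolding compact_def by metis
  have "(real k * r) *\<^sub>R arc_dir l \<in> K" if k: "k \<in> {1..n}" for k
  proof -
    have "isCont (\<lambda>s. infdist ((real k * r) *\<^sub>R arc_dir s) K) l"
      using continuous_on_arc_dir[of UNIV]
      by (intro continuous_infdist continuous_intros) (simp add: continuous_on_eq_continuous_at)
    from isCont_tendsto_compose[OF this lim]
    have "(\<lambda>j. infdist ((real k * r) *\<^sub>R arc_dir (s (\<phi> j))) K) \<longlonglongrightarrow> infdist ((real k * r) *\<^sub>R arc_dir l) K"
      by (simp add: comp_def)
    moreover have "(\<lambda>j. infdist ((real k * r) *\<^sub>R arc_dir (s (\<phi> j))) K) \<longlonglongrightarrow> 0"
    proof (rule tendsto_sandwich[of "\<lambda>_. 0" _ _ "\<lambda>j. r / real (Suc (\<phi> j))"])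
      have "infdist ((real k * r) *\<^sub>R arc_dir (s j)) K \<le> r / real (Suc j)" for j
      proof -
        obtain y where "y \<in> K" "dist y ((real k * r) *\<^sub>R arc_dir (s j)) < r / real (Suc j)"
          using near[OF k] by blast
        then show ?thesis
          using infdist_le[of y K "(real k * r) *\<^sub>R arc_dir (s j)"] by (simp add: dist_commute)
      qed
      then show "\<forall>\<^sub>F j in sequentially. infdist ((real k * r) *\<^sub>R arc_dir (s (\<phi> j))) K \<le> r / real (Suc (\<phi> j))"
        by simp
      have "(\<lambda>j. r / real (Suc j)) \<longlonglongrightarrow> 0"
        by (rule lim_const_over_n[THEN LIMSEQ_Suc])
      then show "(\<lambda>j. r / real (Suc (\<phi> j))) \<longlonglongrightarrow> 0"
        using LIMSEQ_subseq_LIMSEQ[OF _ \<phi>] by (fastforce simp: comp_def)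
    qed (auto simp: infdist_nonneg)
    ultimately have "infdist ((real k * r) *\<^sub>R arc_dir l) K = 0"
      by (rule LIMSEQ_unique)
    \<comment> \<open>\<open>infdist\<close> to the empty set is \<open>0\<close> by convention, so
      nonemptiness has to be known.\<close>
    moreover have "K \<noteq> {}"
      using near[OF k, of 0] by blast
    ultimately show ?thesis
      using compact_imp_closed[OF K] by (simp add: in_closed_iff_infdist_zero)
  qed
  with l show ?thesis
    by blast
qed

text \<open>The unions decrease to the limit superior and the union from \<open>j\<close> on
  contains \<open>G j\<close>, so continuity from above keeps the bound \<open>c\<close>.\<close>

lemma (in prob_space) prob_limsup_ge:
  fixes G :: "nat \<Rightarrow> 'a set"
  assumes G: "\<And>m. G m \<in> events" and c: "\<And>m. c \<le> prob (G m)"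
  shows "c \<le> prob (\<Inter>j. \<Union>m\<in>{j..}. G m)"
proof -
  have [measurable]: "(\<Union>m\<in>{j..}. G m) \<in> events" for j
    using G by (intro sets.countable_UN' countableI_type) auto
  have "(\<lambda>j. prob (\<Union>m\<in>{j..}. G m)) \<longlonglongrightarrow> prob (\<Inter>j. \<Union>m\<in>{j..}. G m)"
    by (intro finite_Lim_measure_decseq) (auto simp: decseq_def intro: order_trans)
  moreover have "c \<le> prob (\<Union>m\<in>{j..}. G m)" for j
    by (rule order_trans[OF c[of j] finite_measure_mono]) auto
  ultimately show ?thesis
    by (intro LIMSEQ_le_const) auto
qed

text \<open>Arbitrarily fine approximations up to one common time \<open>T\<close> meet the
  compactness of the path up to \<open>T\<close>; the term \<open>k = 0\<close> is
  \<open>f 0\<close>.\<close>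

lemma progression_if_infinitely_many_approximate:
  fixes f :: "real \<Rightarrow> real ^ 2"
  assumes f: "f 0 = 0" "continuous_on {0..} f" and r: "r > 0" and T: "T \<ge> 0"
    and approx: "\<And>j. \<exists>m\<ge>j. \<exists>s\<in>{0..1}. \<forall>k\<in>{1..n}. \<exists>t\<in>{0..T}.
      dist (f t) ((real k * r) *\<^sub>R arc_dir s) < r / (4 * real (Suc m))"
  shows "\<exists>x. norm x = r \<and> (\<forall>k\<le>n. real k *\<^sub>R x \<in> f ` {0..})"
proof -
  have "\<exists>s\<in>{0..1}. \<forall>k\<in>{1..n}. (real k * r) *\<^sub>R arc_dir s \<in> f ` {0..T}"
  proof (rule compact_hits_all)
    show "compact (f ` {0..T})"
      using f(2) by (intro compact_continuous_image) (auto intro: continuous_on_subset)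
    fix j
    obtain m s where m: "m \<ge> j" and s: "s \<in> {0..1}"
      and near: "\<forall>k\<in>{1..n}. \<exists>t\<in>{0..T}. dist (f t) ((real k * r) *\<^sub>R arc_dir s) < r / (4 * real (Suc m))"
      using approx by blast
    have "r / (4 * real (Suc m)) \<le> r / real (Suc j)"
      using m r by (intro divide_left_mono) auto
    then show "\<exists>s\<in>{0..1}. \<forall>k\<in>{1..n}. \<exists>y\<in>f ` {0..T}. dist y ((real k * r) *\<^sub>R arc_dir s) < r / real (Suc j)"
      using s near by (intro bexI[of _ s]) (fastforce intro: less_le_trans)+
  qed
  then obtain s where s: "s \<in> {0..1}" and mem: "\<And>k. k \<in> {1..n} \<Longrightarrow> (real k * r) *\<^sub>R arc_dir s \<in> f ` {0..T}"
    by blast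
  have "norm (r *\<^sub>R arc_dir s) = r"
    using s r norm_arc_dir[of s] by simp
  moreover have "real k *\<^sub>R (r *\<^sub>R arc_dir s) \<in> f ` {0..}" if "k \<le> n" for k
  proof (cases "k = 0")
    case True
    then show ?thesis
      using f(1) by (auto intro: image_eqI[of _ _ 0])
  next
    case False
    then show ?thesis
      using mem[of k] that by auto
  qed
  ultimately show ?thesis
    by blast
qed

lemma AE_progression:
  fixes W :: "real \<Rightarrow> 'a \<Rightarrow> real ^ 2"
  assumes bm: "standard_brownian_motion M W" and r: "r > 0" and n: "n \<ge> 1"
  shows "AE \<omega> in M. \<exists>x. norm x = r \<and> (\<forall>k\<le>n. real k *\<^sub>R x \<in> process_trace W \<omega>)"
proof -
  interpret standard_brownian_motion M W by fact
  define B0 where "B0 = 3 + nat \<lceil>16 / r\<^sup>2\<rceil>"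
  define T where "T B = real ((win_lo B (B * n))\<^sup>2)" for B
  define approx where "approx B m \<omega> \<longleftrightarrow> (\<exists>s\<in>{0..1}. \<forall>k\<in>{1..n}. \<exists>t\<in>{0..T B}.
      dist (W t \<omega> - W 0 \<omega>) ((real k * r) *\<^sub>R arc_dir s) < r / (4 * real (Suc m)))" for B m \<omega>
  have "\<exists>G\<in>events. success_bound n r B \<le> prob G \<and> (\<forall>\<omega>\<in>G. approx B m \<omega>)" if "B \<ge> B0" for B m
  proof -
    have "real B \<ge> 3" "real B \<ge> 16 / r\<^sup>2"
      using that by (auto simp: B0_def) linarith+
    then show ?thesis
      using approximate_progression[OF bm n, of "Suc m" r B] r unfolding approx_def T_def by auto
  qed
  then obtain G where G: "\<And>B m. B \<ge> B0 \<Longrightarrow> G B m \<in> events"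
    "\<And>B m. B \<ge> B0 \<Longrightarrow> success_bound n r B \<le> prob (G B m)"
    "\<And>B m \<omega>. B \<ge> B0 \<Longrightarrow> \<omega> \<in> G B m \<Longrightarrow> approx B m \<omega>"
    by metis
  \<comment> \<open>For fixed \<open>B\<close> the events for different \<open>m\<close> share the
    horizon \<open>T B\<close>; infinitely many of them occur with probability at least
    \<open>success_bound n r B\<close>.\<close>
  define Lim where "Lim B = (\<Inter>j. \<Union>m\<in>{j..}. G B m)" for B
  have Lim [measurable]: "Lim B \<in> events" if "B \<ge> B0" for B
    unfolding Lim_def using G(1)[OF that] by (intro sets.countable_INT' sets.countable_UN' countableI_type) auto
  \<comment> \<open>The union over \<open>B\<close> has probability at least every
    \<open>success_bound n r B\<close>, hence \<open>1\<close> in the limit; the ratio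
    \<open>B\<close> that works may depend on the path.\<close>
  define U where "U = (\<Union>B\<in>{B0..}. Lim B)"
  have U: "U \<in> events"
    unfolding U_def by (intro sets.countable_UN' Lim countableI_type) auto
  have "success_bound n r B \<le> prob U" if "B \<ge> B0" for B
  proof -
    have "success_bound n r B \<le> prob (Lim B)"
      unfolding Lim_def using that by (intro prob_limsup_ge G)
    also have "\<dots> \<le> prob U"
      using that U by (intro finite_measure_mono) (auto simp: U_def)
    finally show ?thesis .
  qed
  then have "1 \<le> prob U"
    by (intro LIMSEQ_le_const2[OF success_bound_tendsto]) auto
  then have "AE \<omega> in M. \<omega> \<in> U"
    using U by (intro AE_prob_1) (simp add: antisym)
  with start_at_origin continuous_paths show ?thesis
  proof eventually_elim
    case (elim \<omega>)
    then obtain B where B: "B \<ge> B0" "\<omega> \<in> Lim B"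
      by (auto simp: U_def)
    have "\<exists>m\<ge>j. approx B m \<omega>" for j
    proof -
      obtain m where "m \<ge> j" "\<omega> \<in> G B m"
        using B(2) by (auto simp: Lim_def)
      then show ?thesis
        using G(3)[OF B(1)] by blast
    qed
    then show ?case
      unfolding process_trace_def using elim r
      by (intro progression_if_infinitely_many_approximate[where T = "T B"]) (auto simp: approx_def T_def)
  qed
qed

theorem proposition1:
  fixes M :: "'a measure" and W :: "real \<Rightarrow> 'a \<Rightarrow> real ^ 2" and r :: real
  assumes "standard_brownian_motion M W"
    and "r > 0"
  shows "AE \<omega> in M. \<forall>n::nat. n \<ge> 1 \<longrightarrow>
    (\<exists>x :: real ^ 2. norm x = r \<and> (\<forall>k\<le>n. real k *\<^sub>R x \<in> process_trace W \<omega>))"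
  \<comment> \<open>Only countably many \<open>n\<close> occur, so their exceptional null sets can
    be united.\<close>
  unfolding AE_all_countable using AE_progression[OF assms] by auto

end
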